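(* Let $\Gamma$ be a connected metric graph with a simple graph model $(G,\ell)$, where $G$ has $n\ge 2$ vertices, and let $\ell_{\max,G}$ be the maximum length of an edge of $G$. For every integer $k$ with $0\le k\le n-1$, $$\lambda_k(\Gamma)\;\ge\;\frac{\pi^2}{8\,\ell_{\max,G}^2}\,\lambda_k^{\mathrm{nr}}(G,\ell).$$
   Context: The metric realization of a pair $(G,\ell)$, with $G=(V,E)$ a finite connected graph and $\ell:E\to\mathbb R_{>0}$, is obtained by replacing each edge $e$ by a closed interval of length $\ell_e$ and gluing the intervals at their endpoints according to $G$. A metric graph $\Gamma$ is a metric space isometric to such a realization; $(G,\ell)$ is called a model of $\Gamma$, and a simple graph model if $G$ is a simple graph. Eigenvalues of $\Gamma$: a function $f:\Gamma\to\mathbb R$ is piecewise smooth if, for some subdivision of $\Gamma$ into finitely many closed segments, its restriction to each segment is $C^2$ (in particular $f$ is continuous). $\mathrm{Zh}(\Gamma)$ is the space of piecewise smooth $f$ with $f''\in L^1(\Gamma,dx)$, $dx$ being Lebesgue measure. The Laplacian eigenvalues $0=\lambda_0(\Gamma)<\lambda_1(\Gamma)\le\cdots$ (with multiplicity) are characterized by $$\lambda_k(\Gamma)=\inf_{\substack{\Lambda\subset\mathrm{Zh}(\Gamma)\\ \dim\Lambda=k+1}}\ \sup_{f\in\Lambda\setminus\{0\}}\frac{\int_\Gamma (f')^2dx}{\int_\Gamma f^2dx}.$$ $\lambda_k^{\mathrm{nr}}(G,\ell)$ is the $k$-th eigenvalue (nondecreasing order, with multiplicity, indexed from $0$) of the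 normalized Laplacian associated with the 2-fold cover of $\Gamma$ by the metric stars of the vertices of $G$ (the metric star of $v$ being the union of the edges incident to $v$). Concretely, it is the $k$-th eigenvalue of $S^{-1/2}\Delta S^{-1/2}$ acting on functions $V\to\mathbb R$, where $\Delta(f)(v)=\sum_{u:u\sim v}\ell(\{u,v\})\,(f(v)-f(u))$ and $S(f)(v)=d^\ell_v f(v)$ with $d_v^\ell=\sum_{u:u\sim v}\ell(\{u,v\})$. *)

theory Defs
  imports "HOL-Analysis.Analysis" "HOL-Library.Function_Algebras" "HOL-Library.Multiset"
begin

section \<open>Real-valued functions as a vector space\<close>

definition fscale :: "real \<Rightarrow> ('a \<Rightarrow> real) \<Rightarrow> 'a \<Rightarrow> real"
  where "fscale c f = (\<lambda>x. c * f x)"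

text \<open>Functions on a set \<open>A\<close> are encoded as total functions vanishing outside \<open>A\<close>, so that
  they form a subspace of the following vector space; \<open>fun_vs.subspace\<close> and \<open>fun_vs.dim\<close> are the
  library notions. Note that \<open>fun_vs.dim W = m\<close> with \<open>m > 0\<close> implies that \<open>W\<close> spans a
  finite-dimensional space, as the library dimension of an infinite-dimensional space is \<open>0\<close>.\<close>

interpretation fun_vs: vector_space fscale
  by unfold_locales (auto simp: fscale_def fun_eq_iff algebra_simps)


section \<open>Finite simple graphs with edge lengths\<close>

definition simple_graph :: "'v set \<Rightarrow> 'v set set \<Rightarrow> bool"
  where "simple_graph V E \<longleftrightarrow> finite V \<and> (\<forall>e\<in>E. e \<subseteq> V \<and> card e = 2)"

definition connected_graph :: "'v set \<Rightarrow> 'v set set \<Rightarrow> bool"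
  where "connected_graph V E \<longleftrightarrow> V \<noteq> {} \<and> (\<forall>u\<in>V. \<forall>v\<in>V. (u, v) \<in> {(a, b). {a, b} \<in> E}\<^sup>*)"

definition max_length :: "'v set set \<Rightarrow> ('v set \<Rightarrow> real) \<Rightarrow> real"
  where "max_length E l = Max (l ` E)"


section \<open>The metric realization of a simple graph with edge lengths\<close>

text \<open>A point of the closed edge \<open>e = {u, v}\<close> at distance \<open>t\<close> from \<open>u\<close> is encoded by its
  barycentric coordinates: \<open>1 - t / l e\<close> at \<open>u\<close>, \<open>t / l e\<close> at \<open>v\<close>, and \<open>0\<close> at all other vertices.
  Thus a vertex is encoded by its indicator function whichever edge it is regarded as lying on,
  i.e. the edges are glued at their common endpoints (for a simple graph there is no other
  coincidence), and no orientation of the edges is needed.\<close>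

definition simplex_points :: "'v set \<Rightarrow> ('v \<Rightarrow> real) set"
  where "simplex_points e = {x. (\<forall>w. 0 \<le> x w) \<and> (\<forall>w. w \<notin> e \<longrightarrow> x w = 0) \<and> (\<Sum>w\<in>e. x w) = 1}"

definition realization :: "'v set \<Rightarrow> 'v set set \<Rightarrow> ('v \<Rightarrow> real) set"
  where "realization V E = (\<Union>v\<in>V. simplex_points {v}) \<union> (\<Union>e\<in>E. simplex_points e)"

text \<open>The distance of two points within the interval of length \<open>l e\<close> that replaces \<open>e = {u, v}\<close>.
  The two summands are equal, since \<open>x u + x v = 1 = y u + y v\<close>.\<close>

definition edge_dist :: "('v set \<Rightarrow> real) \<Rightarrow> 'v set \<Rightarrow> ('v \<Rightarrow> real) \<Rightarrow> ('v \<Rightarrow> real) \<Rightarrow> real"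
  where "edge_dist l e x y = l e * ((\<Sum>w\<in>e. \<bar>x w - y w\<bar>) / 2)"

text \<open>The gluing (quotient) metric: the infimum of the total lengths of finite chains of points
  in which any two consecutive points lie on a common edge.\<close>

inductive chain :: "'v set set \<Rightarrow> ('v set \<Rightarrow> real) \<Rightarrow> ('v \<Rightarrow> real) \<Rightarrow> ('v \<Rightarrow> real) \<Rightarrow> real \<Rightarrow> bool"
  for E l where
  chain_refl: "chain E l x x 0"
| chain_step: "e \<in> E \<Longrightarrow> x \<in> simplex_points e \<Longrightarrow> y \<in> simplex_points e \<Longrightarrow> chain E l y z r
    \<Longrightarrow> chain E l x z (edge_dist l e x y + r)"

definition realization_dist :: "'v set set \<Rightarrow> ('v set \<Rightarrow> real) \<Rightarrow> ('v \<Rightarrow> real) \<Rightarrow> ('v \<Rightarrow> real) \<Rightarrow> real"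
  where "realization_dist E l x y = Inf {r. chain E l x y r}"

definition simple_graph_model ::
  "'a set \<Rightarrow> ('a \<Rightarrow> 'a \<Rightarrow> real) \<Rightarrow> 'v set \<Rightarrow> 'v set set \<Rightarrow> ('v set \<Rightarrow> real) \<Rightarrow> bool"
  where "simple_graph_model M d V E l \<longleftrightarrow>
    simple_graph V E \<and> connected_graph V E \<and> (\<forall>e\<in>E. 0 < l e) \<and>
    (\<exists>\<phi>. \<phi> ` realization V E = M \<and>
      (\<forall>x\<in>realization V E. \<forall>y\<in>realization V E. d (\<phi> x) (\<phi> y) = realization_dist E l x y))"


section \<open>Laplacian eigenvalues of a metric graph\<close>

text \<open>A closed segment of length \<open>L\<close> in a metric space \<open>(M, d)\<close> is represented by an arc length
  parametrization \<open>\<gamma>\<close> on \<open>{0..L}\<close>. Being locally (not necessarily globally) isometric is the right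
  condition, because an edge of a metric graph may be longer than the distance of its endpoints.\<close>

definition segment :: "'a set \<Rightarrow> ('a \<Rightarrow> 'a \<Rightarrow> real) \<Rightarrow> real \<times> (real \<Rightarrow> 'a) \<Rightarrow> bool"
  where "segment M d = (\<lambda>(L, \<gamma>). 0 < L \<and> \<gamma> ` {0..L} \<subseteq> M \<and> inj_on \<gamma> {0..L} \<and>
    (\<forall>t\<in>{0..L}. \<exists>\<epsilon>>0. \<forall>r\<in>{0..L}. \<forall>s\<in>{0..L}.
        \<bar>r - t\<bar> < \<epsilon> \<and> \<bar>s - t\<bar> < \<epsilon> \<longrightarrow> d (\<gamma> r) (\<gamma> s) = \<bar>r - s\<bar>))"

text \<open>Distinct segments of a subdivision meet at most in common endpoints.\<close>

definition subdivision :: "'a set \<Rightarrow> ('a \<Rightarrow> 'a \<Rightarrow> real) \<Rightarrow> (real \<times> (real \<Rightarrow> 'a)) set \<Rightarrow> bool"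
  where "subdivision M d S \<longleftrightarrow> finite S \<and> (\<forall>s\<in>S. segment M d s) \<and>
    (\<Union>(L, \<gamma>)\<in>S. \<gamma> ` {0..L}) = M \<and>
    (\<forall>(L, \<gamma>)\<in>S. \<forall>(L', \<gamma>')\<in>S. (L, \<gamma>) \<noteq> (L', \<gamma>') \<longrightarrow> \<gamma> ` {0<..<L} \<inter> \<gamma>' ` {0..L'} = {})"

text \<open>The derivative on \<open>{0..L}\<close>, one-sided at the endpoints.\<close>

definition seg_deriv :: "real \<Rightarrow> (real \<Rightarrow> real) \<Rightarrow> real \<Rightarrow> real"
  where "seg_deriv L g t = vector_derivative g (at t within {0..L})"

definition C2_on_segment :: "real \<Rightarrow> (real \<Rightarrow> real) \<Rightarrow> bool"
  where "C2_on_segment L g \<longleftrightarrow> g differentiable_on {0..L} \<and>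
    seg_deriv L g differentiable_on {0..L} \<and>
    continuous_on {0..L} (seg_deriv L (seg_deriv L g))"

definition smooth_along :: "(real \<times> (real \<Rightarrow> 'a)) set \<Rightarrow> ('a \<Rightarrow> real) \<Rightarrow> bool"
  where "smooth_along S f \<longleftrightarrow> (\<forall>(L, \<gamma>)\<in>S. C2_on_segment L (f \<circ> \<gamma>))"

definition Zh :: "'a set \<Rightarrow> ('a \<Rightarrow> 'a \<Rightarrow> real) \<Rightarrow> ('a \<Rightarrow> real) set"
  where "Zh M d = {f. (\<forall>x. x \<notin> M \<longrightarrow> f x = 0) \<and>
    (\<exists>S. subdivision M d S \<and> smooth_along S f \<and>
      (\<forall>(L, \<gamma>)\<in>S. seg_deriv L (seg_deriv L (f \<circ> \<gamma>)) absolutely_integrable_on {0..L}))}"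

text \<open>The integrals of \<open>f\<^sup>2\<close> and \<open>(f')\<^sup>2\<close> with respect to the Lebesgue measure on \<open>M\<close>, computed along
  the segments of a subdivision. The sign of \<open>f'\<close> depends on the direction of a segment,
  \<open>(f')\<^sup>2\<close> does not.\<close>

definition mass_along :: "(real \<times> (real \<Rightarrow> 'a)) set \<Rightarrow> ('a \<Rightarrow> real) \<Rightarrow> real"
  where "mass_along S f = (\<Sum>(L, \<gamma>)\<in>S. integral {0..L} (\<lambda>t. (f (\<gamma> t))\<^sup>2))"

definition energy_along :: "(real \<times> (real \<Rightarrow> 'a)) set \<Rightarrow> ('a \<Rightarrow> real) \<Rightarrow> real"
  where "energy_along S f = (\<Sum>(L, \<gamma>)\<in>S. integral {0..L} (\<lambda>t. (seg_deriv L (f \<circ> \<gamma>) t)\<^sup>2))"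

text \<open>Both integrals are independent of the choice of a subdivision along which \<open>f\<close> is smooth.\<close>

definition rayleigh :: "'a set \<Rightarrow> ('a \<Rightarrow> 'a \<Rightarrow> real) \<Rightarrow> ('a \<Rightarrow> real) \<Rightarrow> real"
  where "rayleigh M d f =
    (let S = (SOME S. subdivision M d S \<and> smooth_along S f) in energy_along S f / mass_along S f)"

text \<open>Infimum and supremum are taken in the complete lattice of extended reals.\<close>

definition metric_graph_eigenvalue :: "'a set \<Rightarrow> ('a \<Rightarrow> 'a \<Rightarrow> real) \<Rightarrow> nat \<Rightarrow> ereal"
  where "metric_graph_eigenvalue M d k =
    (INF \<Lambda> \<in> {\<Lambda>. fun_vs.subspace \<Lambda> \<and> \<Lambda> \<subseteq> Zh M d \<and> fun_vs.dim \<Lambda> = k + 1}.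
      SUP f \<in> \<Lambda> - {0}. ereal (rayleigh M d f))"


section \<open>The normalized Laplacian of the cover by metric stars\<close>

definition weighted_degree :: "'v set set \<Rightarrow> ('v set \<Rightarrow> real) \<Rightarrow> 'v \<Rightarrow> real"
  where "weighted_degree E l v = (\<Sum>u | {u, v} \<in> E. l {u, v})"

definition weighted_laplacian ::
  "'v set set \<Rightarrow> ('v set \<Rightarrow> real) \<Rightarrow> ('v \<Rightarrow> real) \<Rightarrow> 'v \<Rightarrow> real"
  where "weighted_laplacian E l f v = (\<Sum>u | {u, v} \<in> E. l {u, v} * (f v - f u))"

definition inv_sqrt_degree ::
  "'v set set \<Rightarrow> ('v set \<Rightarrow> real) \<Rightarrow> ('v \<Rightarrow> real) \<Rightarrow> 'v \<Rightarrow> real"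
  where "inv_sqrt_degree E l f v = f v / sqrt (weighted_degree E l v)"

definition normalized_laplacian ::
  "'v set set \<Rightarrow> ('v set \<Rightarrow> real) \<Rightarrow> ('v \<Rightarrow> real) \<Rightarrow> 'v \<Rightarrow> real"
  where "normalized_laplacian E l f =
    inv_sqrt_degree E l (weighted_laplacian E l (inv_sqrt_degree E l f))"

definition eigenspace_on ::
  "'v set \<Rightarrow> (('v \<Rightarrow> real) \<Rightarrow> 'v \<Rightarrow> real) \<Rightarrow> real \<Rightarrow> ('v \<Rightarrow> real) set"
  where "eigenspace_on V T \<mu> = {f. (\<forall>v. v \<notin> V \<longrightarrow> f v = 0) \<and> (\<forall>v\<in>V. T f v = \<mu> * f v)}"

text \<open>The nondecreasing list of eigenvalues, each repeated according to its multiplicity (the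
  dimension of its eigenspace), for a symmetric operator on the functions on a finite set.\<close>

definition eigenvalue_list :: "'v set \<Rightarrow> (('v \<Rightarrow> real) \<Rightarrow> 'v \<Rightarrow> real) \<Rightarrow> real list"
  where "eigenvalue_list V T = sorted_list_of_multiset
    (\<Sum>\<mu> | eigenspace_on V T \<mu> \<noteq> {0}. replicate_mset (fun_vs.dim (eigenspace_on V T \<mu>)) \<mu>)"

definition nr_eigenvalue :: "'v set \<Rightarrow> 'v set set \<Rightarrow> ('v set \<Rightarrow> real) \<Rightarrow> nat \<Rightarrow> real"
  where "nr_eigenvalue V E l k = eigenvalue_list V (normalized_laplacian E l) ! k"

end

theory Submission
  imports Defs
begin

text \<open>
  Let \<open>\<omega> = \<pi> / (2 \<ell>\<^sub>m\<^sub>a\<^sub>x)\<close>. On every metric star, \<open>f\<close> minus its value at the centre vanishes at one end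
  of each edge, so Wirtinger's inequality bounds the energy over the star below by \<open>\<omega>\<^sup>2\<close> times the
  squared distance of \<open>f\<close> to the constants. The stars cover every edge twice; hence
  \<open>\<integral>f'\<^sup>2 \<ge> \<omega>\<^sup>2 (\<integral>f\<^sup>2 - |g|\<^sup>2 / 2)\<close>, where \<open>g\<close> is the vector of the star means of \<open>f\<close>, scaled by the
  square roots of the star lengths. Since \<open>|g|\<^sup>2\<close> depends only on the edge integrals of \<open>f\<close>,
  Cauchy--Schwarz gives \<open>|g|\<^sup>4 \<le> \<integral>f\<^sup>2 \<cdot> \<langle>(2 - N) g, g\<rangle>\<close> for the normalized Laplacian \<open>N\<close>. A space of
  dimension \<open>k + 1\<close> contains some \<open>f \<noteq> 0\<close> with \<open>g\<close> orthogonal to the eigenvectors of the at most \<open>k\<close>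
  eigenvalues of \<open>N\<close> below \<open>\<nu> = \<lambda>\<^sub>k\<close>; then \<open>\<langle>N g, g\<rangle> \<ge> \<nu> |g|\<^sup>2\<close>, so \<open>|g|\<^sup>2 \<le> (2 - \<nu>) \<integral>f\<^sup>2\<close> and the
  energy of \<open>f\<close> is at least \<open>\<omega>\<^sup>2 \<nu> / 2 \<cdot> \<integral>f\<^sup>2\<close>.
\<close>

section \<open>Spectral theory of symmetric operators on finite sets\<close>

text \<open>Since the cover is 2-fold, Cauchy--Schwarz on the stars alone gives only
  \<open>|g|\<^sup>2 \<le> 2 \<integral>f\<^sup>2\<close>, which bounds the energy by 0.
  Orthogonality to the low eigenvectors is what lowers the factor 2 to 2 - \<nu>. The operator 2 - N
  arises because every edge lies in the stars of both its ends: if \<open>x\<close> is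
  \<open>g\<close> divided by the square roots of the weighted degrees and \<open>a e\<close> is the
  integral of \<open>f\<close> over \<open>e\<close>, then \<open>|g|\<^sup>2\<close> is the sum of
  \<open>a e * (x u + x v)\<close> over the edges, while the sum of
  \<open>l e * (x u + x v)\<^sup>2\<close> is the form of 2 - N at \<open>g\<close>. The constant is
  \<open>\<omega>\<^sup>2 / 2 = \<pi>\<^sup>2 / (8 \<ell>\<^sub>m\<^sub>a\<^sub>x\<^sup>2)\<close>,
  the 2 being the multiplicity of the cover. The longest part serves another obstacle:
  \<open>f\<close> is smooth along a subdivision of the abstract metric space that knows nothing of
  the edges; its segments may start inside an edge or pass through a vertex of degree 2. Distance
  estimates show that segments are locally affine of slope 1 or -1 in edge coordinates, so that mass
  and energy can be computed on the edges.\<close>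

lemma homogeneous_system_nontrivial:
  fixes a :: "'i \<Rightarrow> 'b \<Rightarrow> real"
  assumes "finite I" and "finite B" and "card I < card B"
  shows "\<exists>c. (\<exists>b\<in>B. c b \<noteq> 0) \<and> (\<forall>i\<in>I. (\<Sum>b\<in>B. a i b * c b) = 0)"
  using assms
proof (induction I arbitrary: B a rule: finite_induct)
  case empty
  then obtain b where "b \<in> B" by fastforce
  then show ?case by (intro exI[of _ "\<lambda>_. 1"]) auto
next
  case (insert i I)
  show ?case
  proof (cases "\<forall>b\<in>B. a i b = 0")
    case True
    have "card I < card B" using insert by simp
    then obtain c where "\<exists>b\<in>B. c b \<noteq> 0" "\<forall>i\<in>I. (\<Sum>b\<in>B. a i b * c b) = 0"
      using insert.IH[OF insert.prems(1), of a] by blast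
    with True show ?thesis by (intro exI[of _ c]) auto
  next
    case False
    then obtain b0 where b0: "b0 \<in> B" "a i b0 \<noteq> 0" by blast
    define B' where "B' = B - {b0}"
    have B': "finite B'" "card I < card B'"
      using insert b0 by (auto simp: B'_def)
    \<comment> \<open>Gaussian elimination: equation \<open>i\<close> is used to remove the unknown
      \<open>b0\<close> from the others. The coefficients change, hence the induction over arbitrary
      \<open>a\<close>; \<open>c'\<close> below restores the value of \<open>b0\<close> from
      equation \<open>i\<close>.\<close>
    obtain c where c: "\<exists>b\<in>B'. c b \<noteq> 0"
      "\<forall>j\<in>I. (\<Sum>b\<in>B'. (a j b - a j b0 / a i b0 * a i b) * c b) = 0"
      using insert.IH[OF B', of "\<lambda>j b. a j b - a j b0 / a i b0 * a i b"] by auto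
    define s where "s = (\<Sum>b\<in>B'. a i b * c b)"
    define c' where "c' = c(b0 := - s / a i b0)"
    have split: "(\<Sum>b\<in>B. a j b * c' b) = a j b0 * (- s / a i b0) + (\<Sum>b\<in>B'. a j b * c b)" for j
      using insert.prems(1) b0
      by (subst sum.remove[of _ b0]) (auto simp: c'_def B'_def intro!: sum.cong)
    have "(\<Sum>b\<in>B. a j b * c' b) = 0" if "j \<in> I" for j
    proof -
      have "(\<Sum>b\<in>B'. (a j b - a j b0 / a i b0 * a i b) * c b)
          = (\<Sum>b\<in>B'. a j b * c b) - a j b0 / a i b0 * s"
        by (simp only: s_def sum_distrib_left left_diff_distrib sum_subtractf mult.assoc)
      with c(2) that show ?thesis by (simp add: split)
    qed
    moreover have "(\<Sum>b\<in>B. a i b * c' b) = 0"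
      using b0 by (simp add: split s_def[symmetric])
    moreover have "\<exists>b\<in>B. c' b \<noteq> 0"
      using c(1) by (auto simp: c'_def B'_def)
    ultimately show ?thesis by (intro exI[of _ c']) auto
  qed
qed

section \<open>The inner product on functions on a finite set\<close>

definition inner_on :: "'v set \<Rightarrow> ('v \<Rightarrow> real) \<Rightarrow> ('v \<Rightarrow> real) \<Rightarrow> real"
  where "inner_on V f g = (\<Sum>v\<in>V. f v * g v)"

lemma inner_on_commute: "inner_on V f g = inner_on V g f"
  by (simp add: inner_on_def mult.commute)

lemma inner_on_linear:
  "inner_on V (\<lambda>v. a * f v + b * g v) h = a * inner_on V f h + b * inner_on V g h"
  by (simp add: inner_on_def sum.distrib sum_distrib_left algebra_simps)

lemma inner_on_sum:
  "inner_on V (\<lambda>v. \<Sum>b\<in>B. c b * f b v) h = (\<Sum>b\<in>B. c b * inner_on V (f b) h)"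
proof -
  have "inner_on V (\<lambda>v. \<Sum>b\<in>B. c b * f b v) h = (\<Sum>v\<in>V. \<Sum>b\<in>B. c b * f b v * h v)"
    by (simp add: inner_on_def sum_distrib_right)
  also have "\<dots> = (\<Sum>b\<in>B. \<Sum>v\<in>V. c b * f b v * h v)"
    by (rule sum.swap)
  finally show ?thesis
    by (simp add: inner_on_def sum_distrib_left mult.assoc)
qed

lemma inner_on_cong:
  "(\<And>v. v \<in> V \<Longrightarrow> f v = f' v) \<Longrightarrow> (\<And>v. v \<in> V \<Longrightarrow> g v = g' v) \<Longrightarrow> inner_on V f g = inner_on V f' g'"
  by (simp add: inner_on_def)

lemma inner_on_self_nonneg: "0 \<le> inner_on V f f"
  by (simp add: inner_on_def sum_nonneg)

lemma inner_on_self_eq_0: "finite V \<Longrightarrow> inner_on V f f = 0 \<longleftrightarrow> (\<forall>v\<in>V. f v = 0)"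
  by (simp add: inner_on_def sum_nonneg_eq_0_iff)

lemma sum_fun_apply: "(\<Sum>b\<in>B. f b) x = (\<Sum>b\<in>B. (f b :: 'a \<Rightarrow> 'b :: comm_monoid_add) x)"
  by (induction B rule: infinite_finite_induct) (auto simp: zero_fun_def plus_fun_def)

definition orthogonal_complement :: "'v set \<Rightarrow> ('v \<Rightarrow> real) set \<Rightarrow> ('v \<Rightarrow> real) set"
  where "orthogonal_complement V G = {f. (\<forall>v. v \<notin> V \<longrightarrow> f v = 0) \<and> (\<forall>g\<in>G. inner_on V f g = 0)}"

lemma orthogonal_complement_linear:
  assumes "f \<in> orthogonal_complement V G" and "g \<in> orthogonal_complement V G"
  shows "(\<lambda>v. a * f v + b * g v) \<in> orthogonal_complement V G"
  using assms by (auto simp: orthogonal_complement_def inner_on_linear)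

lemma continuous_on_inner_on: "continuous_on S (\<lambda>f. inner_on V f g)"
  unfolding inner_on_def
  by (intro continuous_intros continuous_on_subset[OF continuous_on_product_coordinates]) auto

text \<open>The vertex type may be infinite, so compactness is taken in the product topology: by
  Tychonoff the product of [-1, 1] over \<open>V\<close> and {0} elsewhere is compact, and the
  sphere is a closed subset of it.\<close>

lemma compact_orthogonal_sphere:
  assumes "finite V"
  shows "compact {f \<in> orthogonal_complement V G. inner_on V f f = 1}"
proof -
  have "compactin (product_topology (\<lambda>_. euclidean) UNIV)
          (PiE UNIV (\<lambda>v. if v \<in> V then {-1..1::real} else {0}))"
    by (subst compactin_PiE) auto
  then have c: "compact (PiE UNIV (\<lambda>v. if v \<in> V then {-1..1::real} else {0}))"
    by (simp add: euclidean_product_topology)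
  have *: "closed {f. inner_on V f g = 0}" for g
    by (intro closed_Collect_eq continuous_on_inner_on continuous_on_const)
  have "continuous_on UNIV (\<lambda>f. inner_on V f f)"
    unfolding inner_on_def by (intro continuous_intros continuous_on_product_coordinates)
  then have "closed {f. inner_on V f f = 1}"
    by (intro closed_Collect_eq continuous_on_const)
  then have "compact (PiE UNIV (\<lambda>v. if v \<in> V then {-1..1::real} else {0}) \<inter>
      ((\<Inter>g\<in>G. {f. inner_on V f g = 0}) \<inter> {f. inner_on V f f = 1}))"
    using * by (intro compact_Int_closed[OF c] closed_Int closed_INT) auto
  also have "PiE UNIV (\<lambda>v. if v \<in> V then {-1..1::real} else {0}) \<inter>
      ((\<Inter>g\<in>G. {f. inner_on V f g = 0}) \<inter> {f. inner_on V f f = 1})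
      = {f \<in> orthogonal_complement V G. inner_on V f f = 1}"
  proof -
    have "\<bar>f v\<bar> \<le> 1" if "inner_on V f f = 1" "v \<in> V" for f v
    proof -
      have "f v * f v \<le> inner_on V f f"
        unfolding inner_on_def using that assms by (intro member_le_sum) auto
      then show ?thesis using that abs_square_le_1[of "f v"] by (simp add: power2_eq_square)
    qed
    then have bound: "- 1 \<le> f v \<and> f v \<le> 1" if "inner_on V f f = 1" "v \<in> V" for f v
      using that by (simp add: abs_le_iff minus_le_iff)
    have "f \<in> PiE UNIV (\<lambda>v. if v \<in> V then {-1..1::real} else {0})
        \<longleftrightarrow> (\<forall>v. (v \<in> V \<longrightarrow> - 1 \<le> f v \<and> f v \<le> 1) \<and> (v \<notin> V \<longrightarrow> f v = 0))" for f
      by (auto simp: PiE_iff split: if_splits)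
    with bound show ?thesis by (auto simp: orthogonal_complement_def)
  qed
  finally show ?thesis .
qed

section \<open>Multisets of values repeated with multiplicity\<close>

lemma size_sum_replicate: "size (\<Sum>x\<in>F. replicate_mset (D x) x) = sum D F"
  by (induction F rule: infinite_finite_induct) auto

lemma in_sum_replicate: "y \<in># (\<Sum>x\<in>F. replicate_mset (D x) x) \<Longrightarrow> y \<in> F"
  by (induction F rule: infinite_finite_induct) (auto split: if_splits)

lemma filter_sum_replicate:
  assumes "finite F"
  shows "filter_mset P (\<Sum>x\<in>F. replicate_mset (D x) x)
    = (\<Sum>x\<in>{x\<in>F. P x}. replicate_mset (D x) x)"
proof -
  have "filter_mset P (\<Sum>x\<in>F. replicate_mset (D x) x)
      = (\<Sum>x\<in>F. if P x then replicate_mset (D x) x else {#})"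
  proof (induction F rule: infinite_finite_induct)
    case (insert x F)
    have "filter_mset P (replicate_mset n x) = (if P x then replicate_mset n x else {#})" for n
      by (induction n) auto
    with insert show ?case by simp
  qed auto
  with assms show ?thesis by (simp add: sum.inter_filter)
qed

text \<open>The matrix \<open>A\<close> carries linearity and symmetry. Outside \<open>V\<close>
  nothing is assumed about the values of \<open>T\<close>, in accordance with
  \<open>eigenspace_on\<close>, which tests the eigenvalue equation on \<open>V\<close>
  only.\<close>

locale symmetric_operator =
  fixes V :: "'v set" and A :: "'v \<Rightarrow> 'v \<Rightarrow> real" and T :: "('v \<Rightarrow> real) \<Rightarrow> 'v \<Rightarrow> real"
  assumes finite_V: "finite V"
    and kernel_sym: "u \<in> V \<Longrightarrow> v \<in> V \<Longrightarrow> A u v = A v u"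
    and operator_kernel: "v \<in> V \<Longrightarrow> T f v = (\<Sum>u\<in>V. A v u * f u)"
begin

lemma inner_operator: "inner_on V (T f) g = (\<Sum>v\<in>V. \<Sum>u\<in>V. A v u * f u * g v)"
  by (simp add: inner_on_def operator_kernel sum_distrib_right)

lemma operator_symmetric: "inner_on V (T f) g = inner_on V f (T g)"
proof -
  have "inner_on V (T f) g = (\<Sum>u\<in>V. \<Sum>v\<in>V. A v u * f u * g v)"
    unfolding inner_operator by (rule sum.swap)
  also have "\<dots> = (\<Sum>u\<in>V. \<Sum>v\<in>V. A u v * g v * f u)"
    by (intro sum.cong refl) (simp add: kernel_sym mult_ac)
  also have "\<dots> = inner_on V f (T g)"
    by (simp add: inner_operator inner_on_commute[of V f])
  finally show ?thesis .
qed

lemma inner_operator_linear: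
  "inner_on V (T (\<lambda>v. a * f v + b * g v)) h = a * inner_on V (T f) h + b * inner_on V (T g) h"
  by (simp add: inner_operator sum.distrib sum_distrib_left algebra_simps)

lemma eigenvectors_orthogonal:
  assumes "f \<in> eigenspace_on V T \<mu>" and "g \<in> eigenspace_on V T \<nu>" and "\<mu> \<noteq> \<nu>"
  shows "inner_on V f g = 0"
proof -
  have "inner_on V (T f) g = \<mu> * inner_on V f g"
    using assms(1) by (simp add: inner_on_def eigenspace_on_def sum_distrib_left mult.assoc)
  moreover have "inner_on V f (T g) = \<nu> * inner_on V f g"
    using assms(2) by (simp add: inner_on_def eigenspace_on_def sum_distrib_left mult_ac)
  ultimately show ?thesis using operator_symmetric[of f g] assms(3) by simp
qed

text \<open>A minimizer of the Rayleigh quotient on the orthogonal complement of \<open>G\<close> is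
  an eigenvector, because that complement is invariant under \<open>T\<close> when \<open>G\<close>
  consists of eigenvectors. The minimum is the eigenvalue, so it bounds the quotient of the given
  \<open>f\<close> from below.\<close>

lemma minimal_eigenvector:
  assumes G: "G \<subseteq> (\<Union>\<mu>. eigenspace_on V T \<mu>)"
    and f: "f \<in> orthogonal_complement V G" "f \<noteq> 0"
  obtains \<mu> h where "h \<in> orthogonal_complement V G" "h \<noteq> 0" "h \<in> eigenspace_on V T \<mu>"
    "\<mu> * inner_on V f f \<le> inner_on V (T f) f"
proof -
  define W where "W = orthogonal_complement V G"
  define K where "K = {f \<in> W. inner_on V f f = 1}"
  define q where "q f = inner_on V (T f) f" for f
  have K: "compact K"
    unfolding K_def W_def by (rule compact_orthogonal_sphere[OF finite_V])
  have contq: "continuous_on K q"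
    unfolding q_def inner_operator
    by (intro continuous_intros continuous_on_subset[OF continuous_on_product_coordinates]) auto
  have normalize: "\<exists>c>0. (\<lambda>v. c * f v) \<in> K \<and> c\<^sup>2 * inner_on V f f = 1"
    if "f \<in> W" "f \<noteq> 0" for f
  proof -
    have "inner_on V f f \<noteq> 0"
      using that finite_V
      by (auto simp: inner_on_self_eq_0 W_def orthogonal_complement_def fun_eq_iff)
    then have p: "inner_on V f f > 0" using inner_on_self_nonneg[of V f] by linarith
    define c where "c = 1 / sqrt (inner_on V f f)"
    have c: "c > 0" "c\<^sup>2 * inner_on V f f = 1" using p by (auto simp: c_def power_divide)
    have "inner_on V (\<lambda>v. c * f v) (\<lambda>v. c * f v) = c\<^sup>2 * inner_on V f f"
      by (simp add: inner_on_def sum_distrib_left power2_eq_square mult_ac)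
    then have "(\<lambda>v. c * f v) \<in> K"
      using that orthogonal_complement_linear[of f V G f c 0] c(2)
      by (simp add: K_def W_def)
    with c show ?thesis by blast
  qed
  have "K \<noteq> {}" using normalize[of f] f by (auto simp: W_def)
  then obtain h where h: "h \<in> K" "\<And>g. g \<in> K \<Longrightarrow> q h \<le> q g"
    using continuous_attains_inf[OF K _ contq] by blast
  define \<mu> where "\<mu> = q h"
  have h1: "h \<in> W" "inner_on V h h = 1" using h by (auto simp: K_def)
  have min: "\<mu> * inner_on V g g \<le> q g" if g: "g \<in> W" for g
  proof (cases "g = 0")
    case True
    then show ?thesis by (simp add: q_def inner_on_def)
  next
    case False
    obtain c where c: "c > 0" "(\<lambda>v. c * g v) \<in> K" "c\<^sup>2 * inner_on V g g = 1"
      using normalize[OF g False] by blast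
    have "q (\<lambda>v. c * g v) = c\<^sup>2 * q g"
      by (simp add: q_def inner_operator sum_distrib_left power2_eq_square mult_ac)
    then have "\<mu> \<le> c\<^sup>2 * q g" using h(2)[OF c(2)] by (simp add: \<mu>_def)
    then have "\<mu> * (c\<^sup>2 * inner_on V g g) \<le> c\<^sup>2 * q g" using c(3) by simp
    then have "c\<^sup>2 * (\<mu> * inner_on V g g) \<le> c\<^sup>2 * q g" by (simp add: mult_ac)
    then show ?thesis using c(1) by simp
  qed
  define r where "r v = (if v \<in> V then T h v - \<mu> * h v else 0)" for v
  have ipr: "inner_on V r g = inner_on V (T h) g - \<mu> * inner_on V h g" for g
  proof -
    have "inner_on V r g = inner_on V (\<lambda>v. 1 * T h v + (- \<mu>) * h v) g"
      by (intro inner_on_cong) (auto simp: r_def)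
    then show ?thesis by (simp only: inner_on_linear)
  qed
  \<comment> \<open>Invariance of the complement: the residual \<open>r\<close> of the eigenvalue
    equation at the minimizer is itself an admissible direction of variation.\<close>
  have rW: "r \<in> W"
    unfolding W_def orthogonal_complement_def
  proof (safe)
    fix g assume "g \<in> G"
    then obtain \<nu> where "g \<in> eigenspace_on V T \<nu>" using G by blast
    then have "inner_on V h (T g) = \<nu> * inner_on V h g"
      by (simp add: inner_on_def eigenspace_on_def sum_distrib_left mult_ac)
    moreover have "inner_on V h g = 0"
      using h1 \<open>g \<in> G\<close> by (simp add: W_def orthogonal_complement_def)
    ultimately show "inner_on V r g = 0" by (simp add: ipr operator_symmetric)
  qed (simp add: r_def)
  define R where "R = inner_on V r r"
  define C where "C = q r - \<mu> * R"
  have C: "C \<ge> 0" using min[OF rW] by (simp add: C_def R_def)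
  \<comment> \<open>Minimality at \<open>h + t r\<close>. The linear coefficient is twice the inner
    product of the residual with \<open>r\<close>, that is, \<open>2 * R\<close>; the terms of order
    zero cancel.\<close>
  have expand: "0 \<le> 2 * t * R + t\<^sup>2 * C" for t
  proof -
    let ?g = "\<lambda>v. 1 * h v + t * r v"
    have q: "q ?g = q h + 2 * t * inner_on V (T h) r + t\<^sup>2 * q r"
    proof -
      have "q ?g = inner_on V (T h) ?g + t * inner_on V (T r) ?g"
        unfolding q_def by (subst inner_operator_linear) simp
      also have "inner_on V (T h) ?g = q h + t * inner_on V (T h) r"
        by (subst inner_on_commute, subst inner_on_linear)
          (simp add: q_def inner_on_commute[of V _ "T h"])
      also have "inner_on V (T r) ?g = inner_on V (T h) r + t * q r"
        by (subst inner_on_commute, subst inner_on_linear)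
          (simp add: q_def operator_symmetric[of h r] inner_on_commute[of V _ "T r"])
      finally show ?thesis by (simp add: power2_eq_square algebra_simps)
    qed
    have i: "inner_on V ?g ?g = 1 + 2 * t * inner_on V h r + t\<^sup>2 * R"
    proof -
      have "inner_on V ?g ?g = inner_on V h ?g + t * inner_on V r ?g"
        by (subst inner_on_linear) simp
      also have "inner_on V h ?g = 1 + t * inner_on V h r"
        by (subst inner_on_commute, subst inner_on_linear)
          (simp add: h1 inner_on_commute[of V r h])
      also have "inner_on V r ?g = inner_on V h r + t * R"
        by (subst inner_on_commute, subst inner_on_linear) (simp add: R_def)
      finally show ?thesis by (simp add: power2_eq_square algebra_simps)
    qed
    have "?g \<in> W"
      using orthogonal_complement_linear[of h V G r 1 t] h1 rW by (simp add: W_def)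
    from min[OF this] have "0 \<le> 2 * t * (inner_on V (T h) r - \<mu> * inner_on V h r) + t\<^sup>2 * C"
      unfolding q i by (simp add: \<mu>_def[symmetric] C_def algebra_simps)
    then show ?thesis using ipr[of r] by (simp add: R_def)
  qed
  have "R = 0"
  proof -
    \<comment> \<open>At \<open>t = - u\<close> the quadratic in \<open>expand\<close> equals
      \<open>- u\<^sup>2 * (C + 2)\<close>. The 1 in the denominator avoids division by zero when
      \<open>C = 0\<close>.\<close>
    define u where "u = R / (C + 1)"
    have R: "R = u * (C + 1)" using C by (simp add: u_def)
    have "0 \<le> 2 * (- u) * R + (- u)\<^sup>2 * C" by (rule expand)
    then have "u\<^sup>2 * (C + 2) \<le> 0" by (simp add: R power2_eq_square algebra_simps)
    with C have "u = 0" by (simp add: mult_le_0_iff)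
    then show ?thesis by (simp add: R)
  qed
  then have "\<forall>v\<in>V. r v = 0" using finite_V by (simp add: R_def inner_on_self_eq_0)
  then have "h \<in> eigenspace_on V T \<mu>"
    using h1 by (auto simp: eigenspace_on_def r_def W_def orthogonal_complement_def)
  moreover have "h \<noteq> 0" using h1 by (auto simp: inner_on_def)
  ultimately show ?thesis using that[of h \<mu>] h1 min[of f] f by (auto simp: W_def q_def)
qed

text \<open>Eigenvectors of distinct eigenvalues are orthogonal, and more than \<open>card V\<close>
  vectors on \<open>V\<close> admit a linear relation. Finiteness gives
  \<open>eigenvalue_list\<close> its meaning, since a sum over an infinite set of eigenvalues would
  be the empty multiset.\<close>

lemma finite_eigenvalues: "finite {\<mu>. eigenspace_on V T \<mu> \<noteq> {0}}"
proof -
  define Es where "Es = {\<mu>. eigenspace_on V T \<mu> \<noteq> {0}}"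
  have "\<exists>f. f \<in> eigenspace_on V T \<mu> \<and> f \<noteq> 0" if "\<mu> \<in> Es" for \<mu>
  proof -
    have "0 \<in> eigenspace_on V T \<mu>"
      by (simp add: eigenspace_on_def operator_kernel)
    with that show ?thesis by (auto simp: Es_def)
  qed
  then obtain F where F: "\<And>\<mu>. \<mu> \<in> Es \<Longrightarrow> F \<mu> \<in> eigenspace_on V T \<mu> \<and> F \<mu> \<noteq> 0"
    by metis
  have orth: "inner_on V (F \<mu>) (F \<nu>) = 0" if "\<mu> \<in> Es" "\<nu> \<in> Es" "\<mu> \<noteq> \<nu>" for \<mu> \<nu>
    using eigenvectors_orthogonal F that by blast
  have pos: "inner_on V (F \<mu>) (F \<mu>) \<noteq> 0" if "\<mu> \<in> Es" for \<mu>
    using F[OF that] finite_V by (auto simp: inner_on_self_eq_0 eigenspace_on_def fun_eq_iff)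
  show "finite {\<mu>. eigenspace_on V T \<mu> \<noteq> {0}}"
  proof (rule ccontr)
    assume "infinite {\<mu>. eigenspace_on V T \<mu> \<noteq> {0}}"
    then obtain Q where Q: "Q \<subseteq> Es" "finite Q" "card Q = Suc (card V)"
      using infinite_arbitrarily_large Es_def by metis
    obtain c where c: "\<exists>\<mu>\<in>Q. c \<mu> \<noteq> 0" "\<forall>v\<in>V. (\<Sum>\<mu>\<in>Q. F \<mu> v * c \<mu>) = 0"
      using homogeneous_system_nontrivial[OF finite_V Q(2), of "\<lambda>v \<mu>. F \<mu> v"] Q(3) by auto
    then obtain \<nu> where \<nu>: "\<nu> \<in> Q" "c \<nu> \<noteq> 0" by blast
    have "0 = inner_on V (\<lambda>v. \<Sum>\<mu>\<in>Q. c \<mu> * F \<mu> v) (F \<nu>)"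
      using c(2) by (simp add: inner_on_def mult.commute)
    also have "\<dots> = (\<Sum>\<mu>\<in>Q. c \<mu> * inner_on V (F \<mu>) (F \<nu>))" by (rule inner_on_sum)
    also have "\<dots> = (\<Sum>\<mu>\<in>Q. if \<mu> = \<nu> then c \<nu> * inner_on V (F \<nu>) (F \<nu>) else 0)"
      using Q \<nu> orth by (intro sum.cong) auto
    also have "\<dots> = c \<nu> * inner_on V (F \<nu>) (F \<nu>)" using Q \<nu> by simp
    finally show False using \<nu> pos Q by auto
  qed
qed

text \<open>The indicator functions of the points of \<open>V\<close> span all functions vanishing
  off \<open>V\<close>, so a basis is finite. Otherwise \<open>card B\<close> would be 0 by
  convention and say nothing about its size.\<close>

lemma eigenspace_spanning_set:
  obtains B where "B \<subseteq> eigenspace_on V T \<mu>" "finite B"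
    "card B = fun_vs.dim (eigenspace_on V T \<mu>)" "eigenspace_on V T \<mu> \<subseteq> fun_vs.span B"
proof -
  obtain B where B: "B \<subseteq> eigenspace_on V T \<mu>" "fun_vs.independent B"
    "eigenspace_on V T \<mu> \<subseteq> fun_vs.span B" "card B = fun_vs.dim (eigenspace_on V T \<mu>)"
    using fun_vs.basis_exists .
  let ?I = "(\<lambda>v w. if w = v then 1 else 0 :: real) ` V"
  have "B \<subseteq> fun_vs.span ?I"
  proof
    fix f assume "f \<in> B"
    then have f: "\<And>v. v \<notin> V \<Longrightarrow> f v = 0" using B(1) by (auto simp: eigenspace_on_def)
    have "f = (\<Sum>v\<in>V. fscale (f v) (\<lambda>w. if w = v then 1 else 0))"
      using finite_V f by (auto simp: fun_eq_iff sum_fun_apply fscale_def mult_delta_right)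
    also have "\<dots> \<in> fun_vs.span ?I"
      by (intro fun_vs.span_sum fun_vs.span_scale fun_vs.span_base) auto
    finally show "f \<in> fun_vs.span ?I" .
  qed
  then have "finite B"
    using fun_vs.independent_span_bound[of ?I B] B(2) finite_V by simp
  with B that show ?thesis by blast
qed

lemma orthogonal_to_span:
  assumes "\<And>b. b \<in> B \<Longrightarrow> inner_on V f b = 0" and "g \<in> fun_vs.span B"
  shows "inner_on V f g = 0"
proof -
  have "fun_vs.subspace {g. inner_on V f g = 0}"
    by (auto simp: fun_vs.subspace_def inner_on_def fscale_def distrib_left sum.distrib
      mult.left_commute sum_distrib_left[symmetric])
  then have "fun_vs.span B \<subseteq> {g. inner_on V f g = 0}"
    using assms(1) by (intro fun_vs.span_minimal) auto
  with assms(2) show ?thesis by blast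
qed

text \<open>\<open>G\<close> is the union of bases of the eigenspaces below \<open>\<nu>\<close>. In
  the sorted list only positions before \<open>k\<close> can hold entries below entry
  \<open>k\<close>, so \<open>G\<close> has at most \<open>k\<close> elements. A vector violating
  the inequality would yield an eigenvalue below \<open>\<nu>\<close> with an eigenvector orthogonal
  to its own eigenspace.\<close>

lemma eigenvalue_list_nth:
  assumes "k < card V"
  defines "\<nu> \<equiv> eigenvalue_list V T ! k"
  obtains G where "finite G" "card G \<le> k"
    and "\<And>f. f \<in> orthogonal_complement V G \<Longrightarrow> \<nu> * inner_on V f f \<le> inner_on V (T f) f"
    and "eigenspace_on V T \<nu> \<noteq> {0}"
proof -
  define Es where "Es = {\<mu>. eigenspace_on V T \<mu> \<noteq> {0}}"
  define D where "D \<mu> = fun_vs.dim (eigenspace_on V T \<mu>)" for \<mu>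
  define xs where "xs = eigenvalue_list V T"
  have fin: "finite Es" unfolding Es_def by (rule finite_eigenvalues)
  have "\<exists>B. B \<subseteq> eigenspace_on V T \<mu> \<and> finite B \<and> card B = D \<mu> \<and> eigenspace_on V T \<mu> \<subseteq> fun_vs.span B"
    for \<mu> using eigenspace_spanning_set[of \<mu>] unfolding D_def by metis
  then obtain B where B: "\<And>\<mu>. B \<mu> \<subseteq> eigenspace_on V T \<mu>" "\<And>\<mu>. finite (B \<mu>)"
    "\<And>\<mu>. card (B \<mu>) = D \<mu>" "\<And>\<mu>. eigenspace_on V T \<mu> \<subseteq> fun_vs.span (B \<mu>)" by metis
  have mset: "mset xs = (\<Sum>\<mu>\<in>Es. replicate_mset (D \<mu>) \<mu>)"
    by (simp add: xs_def eigenvalue_list_def Es_def D_def)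
  have sorted: "sorted xs" by (simp add: xs_def eigenvalue_list_def)
  have not_orth: False if "h \<noteq> 0" "h \<in> eigenspace_on V T \<mu>" "\<And>b. b \<in> B \<mu> \<Longrightarrow> inner_on V h b = 0" for h \<mu>
  proof -
    have "inner_on V h h = 0" using that B(4) by (blast intro: orthogonal_to_span)
    then have "h = 0"
      using that(2) finite_V by (auto simp: inner_on_self_eq_0 eigenspace_on_def fun_eq_iff)
    with that show False by simp
  qed
  \<comment> \<open>This makes \<open>! k\<close> a genuine entry of the list. If there were fewer
    than \<open>card V\<close> basis vectors in total, some nonzero vector would be orthogonal to
    all of them, and minimizing on their complement would produce one more eigenvector.\<close>
  have len: "length xs \<ge> card V"
  proof (rule ccontr)
    assume *: "\<not> card V \<le> length xs"
    have "length xs = (\<Sum>\<mu>\<in>Es. D \<mu>)"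
      using arg_cong[OF mset, of size] by (simp add: size_sum_replicate)
    moreover have "card (\<Union>\<mu>\<in>Es. B \<mu>) \<le> (\<Sum>\<mu>\<in>Es. D \<mu>)"
      using card_UN_le[OF fin, of B] B(3) by simp
    ultimately have "card (\<Union>\<mu>\<in>Es. B \<mu>) < card V" using * by linarith
    then obtain c where c: "\<exists>v\<in>V. c v \<noteq> 0" "\<forall>b\<in>(\<Union>\<mu>\<in>Es. B \<mu>). (\<Sum>v\<in>V. b v * c v) = 0"
      using homogeneous_system_nontrivial[of "\<Union>\<mu>\<in>Es. B \<mu>" V "\<lambda>b v. b v"] fin B finite_V by auto
    define f where "f v = (if v \<in> V then c v else 0)" for v
    have sub: "(\<Union>\<mu>\<in>Es. B \<mu>) \<subseteq> (\<Union>\<mu>. eigenspace_on V T \<mu>)" using B(1) by auto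
    have f: "f \<in> orthogonal_complement V (\<Union>\<mu>\<in>Es. B \<mu>)"
      using c(2) by (auto simp: orthogonal_complement_def f_def inner_on_def mult.commute)
    have "f \<noteq> 0" using c(1) by (auto simp: f_def fun_eq_iff)
    from minimal_eigenvector[OF sub f this]
    obtain \<mu> h where h: "h \<in> orthogonal_complement V (\<Union>\<mu>\<in>Es. B \<mu>)" "h \<noteq> 0"
        "h \<in> eigenspace_on V T \<mu>" by metis
    then have "\<mu> \<in> Es" by (auto simp: Es_def)
    then show False using not_orth[OF h(2,3)] h(1) by (auto simp: orthogonal_complement_def)
  qed
  have "\<nu> \<in># mset xs" using len assms by (simp add: xs_def)
  then have \<nu>: "\<nu> \<in> Es"
    unfolding mset by (rule in_sum_replicate)
  define Low where "Low = {\<mu>\<in>Es. \<mu> < \<nu>}"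
  define G where "G = (\<Union>\<mu>\<in>Low. B \<mu>)"
  have finLow: "finite Low" by (simp add: Low_def fin)
  have "(\<Sum>\<mu>\<in>Low. D \<mu>) \<le> k"
  proof -
    have "(\<Sum>\<mu>\<in>Low. D \<mu>) = size (filter_mset (\<lambda>x. x < \<nu>) (mset xs))"
      unfolding mset Low_def using fin by (simp add: filter_sum_replicate size_sum_replicate)
    also have "\<dots> = length (filter (\<lambda>x. x < \<nu>) xs)"
      by (metis mset_filter size_mset)
    also have "\<dots> = card {i. i < length xs \<and> xs ! i < \<nu>}" by (rule length_filter_conv_card)
    also have "\<dots> \<le> card {..<k}"
    proof (rule card_mono)
      show "{i. i < length xs \<and> xs ! i < \<nu>} \<subseteq> {..<k}"
      proof (safe, rule ccontr)
        fix i assume i: "i < length xs" "xs ! i < \<nu>" "\<not> i < k"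
        then have "xs ! k \<le> xs ! i" using sorted by (intro sorted_nth_mono) auto
        then show False using i by (simp add: assms xs_def)
      qed
    qed simp
    finally show ?thesis by simp
  qed
  then have "card G \<le> k"
    using card_UN_le[OF finLow, of B] B(3) unfolding G_def by simp
  moreover have "finite G" using finLow B by (auto simp: G_def)
  moreover have "\<nu> * inner_on V f f \<le> inner_on V (T f) f" if f: "f \<in> orthogonal_complement V G" for f
  proof (cases "f = 0")
    case True
    then show ?thesis by (simp add: inner_on_def)
  next
    case False
    have "G \<subseteq> (\<Union>\<mu>. eigenspace_on V T \<mu>)" using B(1) by (auto simp: G_def)
    from minimal_eigenvector[OF this f False]
    obtain \<mu> h where h: "h \<in> orthogonal_complement V G" "h \<noteq> 0" "h \<in> eigenspace_on V T \<mu>"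
      "\<mu> * inner_on V f f \<le> inner_on V (T f) f" by metis
    have "\<nu> \<le> \<mu>"
    proof (rule ccontr)
      assume "\<not> \<nu> \<le> \<mu>"
      then have "\<mu> \<in> Low" using h by (auto simp: Low_def Es_def)
      then show False using not_orth[OF h(2,3)] h(1) by (auto simp: orthogonal_complement_def G_def)
    qed
    then have "\<nu> * inner_on V f f \<le> \<mu> * inner_on V f f"
      by (intro mult_right_mono inner_on_self_nonneg)
    with h(4) show ?thesis by linarith
  qed
  ultimately show ?thesis using that \<nu> by (simp add: Es_def)
qed

end

section \<open>Wirtinger inequalities on an interval\<close>

text \<open>If \<open>h' = - (\<omega>\<^sup>2 + h\<^sup>2)\<close>, then \<open>D\<^sup>2 - \<omega>\<^sup>2 g\<^sup>2 = (D - h g)\<^sup>2 + (h g\<^sup>2)'\<close> for \<open>D = g'\<close>.\<close>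

lemma riccati_inequality:
  fixes g D h :: "real \<Rightarrow> real"
  assumes l: "0 \<le> l" and K: "finite K" and g: "continuous_on {0..l} g"
    and D: "\<And>x. x \<in> {0<..<l} - K \<Longrightarrow> (g has_real_derivative D x) (at x)"
    and D2: "(\<lambda>x. (D x)\<^sup>2) integrable_on {0..l}"
    and h: "\<And>x. x \<in> {0..l} \<Longrightarrow> (h has_real_derivative - (\<omega>\<^sup>2 + (h x)\<^sup>2)) (at x)"
    and boundary: "h 0 * (g 0)\<^sup>2 \<le> h l * (g l)\<^sup>2"
  shows "\<omega>\<^sup>2 * integral {0..l} (\<lambda>x. (g x)\<^sup>2) \<le> integral {0..l} (\<lambda>x. (D x)\<^sup>2)"
proof -
  define P where "P x = - (\<omega>\<^sup>2 + (h x)\<^sup>2) * (g x)\<^sup>2 + h x * (2 * g x * D x)" for x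
  have h_cont: "continuous_on {0..l} h"
    using h by (intro DERIV_continuous_on) (auto intro: has_field_derivative_at_within)
  have P: "(P has_integral h l * (g l)\<^sup>2 - h 0 * (g 0)\<^sup>2) {0..l}"
  proof (rule fundamental_theorem_of_calculus_interior_strong[OF K l])
    fix x assume x: "x \<in> {0<..<l} - K"
    have "((\<lambda>x. h x * (g x)\<^sup>2) has_real_derivative P x) (at x)"
      unfolding P_def using x by (auto intro!: derivative_eq_intros h D)
    then show "((\<lambda>x. h x * (g x)\<^sup>2) has_vector_derivative P x) (at x)"
      by (simp add: has_real_derivative_iff_has_vector_derivative)
  qed (intro continuous_intros h_cont g)
  have g2: "(\<lambda>x. (g x)\<^sup>2) integrable_on {0..l}"
    by (intro integrable_continuous_interval continuous_intros g)
  have "((\<lambda>x. (D x)\<^sup>2 - \<omega>\<^sup>2 * (g x)\<^sup>2) has_integral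
      integral {0..l} (\<lambda>x. (D x)\<^sup>2) - \<omega>\<^sup>2 * integral {0..l} (\<lambda>x. (g x)\<^sup>2)) {0..l}"
    by (intro has_integral_diff has_integral_mult_right integrable_integral D2 g2)
  moreover have "P x \<le> (D x)\<^sup>2 - \<omega>\<^sup>2 * (g x)\<^sup>2" for x
    using zero_le_power2[of "D x - h x * g x"]
    by (simp add: P_def power2_eq_square algebra_simps)
  ultimately have "h l * (g l)\<^sup>2 - h 0 * (g 0)\<^sup>2
      \<le> integral {0..l} (\<lambda>x. (D x)\<^sup>2) - \<omega>\<^sup>2 * integral {0..l} (\<lambda>x. (g x)\<^sup>2)"
    using has_integral_le[OF P] by blast
  with boundary show ?thesis by simp
qed

text \<open>This is the logarithmic derivative of \<open>sin (a * x + b)\<close>, which has no pole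
  while the argument stays between 0 and \<pi>. A negative \<open>a\<close> is allowed, so the
  solution can be run in either direction.\<close>

lemma cot_riccati:
  assumes "0 < a * x + b" and "a * x + b < pi"
  shows "((\<lambda>x. a * cot (a * x + b)) has_real_derivative
    - (a\<^sup>2 + (a * cot (a * x + b))\<^sup>2)) (at x)"
proof -
  have s: "sin (a * x + b) > 0" using assms by (rule sin_gt_zero)
  have "a * (- inverse ((sin (a * x + b))\<^sup>2) * a) = - (a\<^sup>2 + (a * cot (a * x + b))\<^sup>2)"
  proof -
    have "a\<^sup>2 + (a * cot (a * x + b))\<^sup>2
        = a\<^sup>2 * ((sin (a * x + b))\<^sup>2 + (cos (a * x + b))\<^sup>2) / (sin (a * x + b))\<^sup>2"
    proof -
      have "a\<^sup>2 + (a * (c / t))\<^sup>2 = a\<^sup>2 * (t\<^sup>2 + c\<^sup>2) / t\<^sup>2" if "t \<noteq> 0" for c t :: real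
        using that by (simp add: field_simps)
      with s show ?thesis unfolding cot_def by simp
    qed
    also have "\<dots> = a\<^sup>2 / (sin (a * x + b))\<^sup>2" by simp
    finally show ?thesis by (simp add: power2_eq_square divide_inverse)
  qed
  moreover have "((\<lambda>x. cot (a * x + b)) has_real_derivative - inverse ((sin (a * x + b))\<^sup>2) * a) (at x)"
    by (rule DERIV_chain2[OF DERIV_cot]) (use s in \<open>auto intro!: derivative_eq_intros\<close>)
  then have "((\<lambda>x. a * cot (a * x + b)) has_real_derivative
      a * (- inverse ((sin (a * x + b))\<^sup>2) * a)) (at x)"
    by (rule DERIV_cmult)
  ultimately show ?thesis by simp
qed

text \<open>The extremal function is a quarter period of a sine vanishing at the fixed end. At the
  sharp frequency its logarithmic derivative has a pole there, so the inequality is proved for every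
  smaller \<omega> and passes to the limit.\<close>

lemma wirtinger_one_endpoint:
  fixes g D :: "real \<Rightarrow> real"
  assumes l: "0 < l" and K: "finite K" and g: "continuous_on {0..l} g"
    and D: "\<And>x. x \<in> {0<..<l} - K \<Longrightarrow> (g has_real_derivative D x) (at x)"
    and D2: "(\<lambda>x. (D x)\<^sup>2) integrable_on {0..l}"
    and zero: "g 0 = 0 \<or> g l = 0"
  shows "(pi / (2 * l))\<^sup>2 * integral {0..l} (\<lambda>x. (g x)\<^sup>2) \<le> integral {0..l} (\<lambda>x. (D x)\<^sup>2)"
proof -
  define m where "m = pi / (2 * l)"
  have m: "m > 0" using l by (simp add: m_def)
  have ml: "m * l = pi / 2" using l by (simp add: m_def)
  have *: "\<omega>\<^sup>2 * integral {0..l} (\<lambda>x. (g x)\<^sup>2) \<le> integral {0..l} (\<lambda>x. (D x)\<^sup>2)"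
    if \<omega>: "0 < \<omega>" "\<omega> < m" for \<omega>
  proof -
    have wl: "\<omega> * l < pi / 2"
      using mult_strict_right_mono[OF \<omega>(2) l] ml by simp
    have range: "0 \<le> \<omega> * x \<and> \<omega> * x \<le> \<omega> * l" if "x \<in> {0..l}" for x
      using that \<omega> by (auto intro: mult_left_mono)
    from zero show ?thesis
    proof
      \<comment> \<open>The phase \<open>pi / 2 - \<omega> * l\<close> makes the cotangent vanish at
        the free end \<open>l\<close>; at 0 the factor \<open>g 0\<close> kills the boundary
        term.\<close>
      assume "g 0 = 0"
      show ?thesis
      proof (rule riccati_inequality[OF less_imp_le[OF l] K g D D2])
        fix x assume "x \<in> {0..l}"
        then show "((\<lambda>x. \<omega> * cot (\<omega> * x + (pi / 2 - \<omega> * l))) has_real_derivative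
            - (\<omega>\<^sup>2 + (\<omega> * cot (\<omega> * x + (pi / 2 - \<omega> * l)))\<^sup>2)) (at x)"
          using range[of x] wl pi_gt_zero by (intro cot_riccati) linarith+
      qed (use \<open>g 0 = 0\<close> in \<open>auto simp: cot_def\<close>)
    next
      \<comment> \<open>Mirror image: the function used is
        \<open>- \<omega> * tan (\<omega> * x)\<close>, written as a cotangent, which vanishes at
        the free end 0.\<close>
      assume "g l = 0"
      show ?thesis
      proof (rule riccati_inequality[OF less_imp_le[OF l] K g D D2])
        fix x assume "x \<in> {0..l}"
        then show "((\<lambda>x. (- \<omega>) * cot ((- \<omega>) * x + pi / 2)) has_real_derivative
            - (\<omega>\<^sup>2 + ((- \<omega>) * cot ((- \<omega>) * x + pi / 2))\<^sup>2)) (at x)"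
          using range[of x] wl pi_gt_zero cot_riccati[of "- \<omega>" x "pi / 2"] by fastforce
      qed (use \<open>g l = 0\<close> in \<open>auto simp: cot_def\<close>)
    qed
  qed
  have "((\<lambda>\<omega>. \<omega>\<^sup>2 * integral {0..l} (\<lambda>x. (g x)\<^sup>2)) \<longlongrightarrow> m\<^sup>2 * integral {0..l} (\<lambda>x. (g x)\<^sup>2)) (at_left m)"
    by (intro tendsto_intros)
  moreover have "\<forall>\<^sub>F \<omega> in at_left m.
      \<omega>\<^sup>2 * integral {0..l} (\<lambda>x. (g x)\<^sup>2) \<le> integral {0..l} (\<lambda>x. (D x)\<^sup>2)"
    using m * by (intro eventually_at_leftI[of 0]) auto
  ultimately show ?thesis
    unfolding m_def[symmetric] by (rule tendsto_upperbound) simp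
qed

text \<open>Expand the nonnegative integral of the square of \<open>g - c\<close>, where
  \<open>c\<close> is the mean of \<open>g\<close>.\<close>

lemma integral_square_le:
  fixes g :: "real \<Rightarrow> real"
  assumes l: "0 < l" and g: "continuous_on {0..l} g"
  shows "(integral {0..l} g)\<^sup>2 \<le> l * integral {0..l} (\<lambda>x. (g x)\<^sup>2)"
proof -
  have gi: "g integrable_on {0..l}" "(\<lambda>x. (g x)\<^sup>2) integrable_on {0..l}"
    by (intro integrable_continuous_interval continuous_intros g)+
  define c where "c = integral {0..l} g / l"
  have i: "((\<lambda>x. (g x)\<^sup>2 - 2 * c * g x + c\<^sup>2) has_integral
      integral {0..l} (\<lambda>x. (g x)\<^sup>2) - 2 * c * integral {0..l} g + (l - 0) *\<^sub>R c\<^sup>2) {0..l}"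
    using l has_integral_const_real[of "c\<^sup>2" 0 l]
    by (intro has_integral_add[OF has_integral_diff] has_integral_mult_right integrable_integral gi)
      simp
  have "0 \<le> (g x)\<^sup>2 - 2 * c * g x + c\<^sup>2" for x
    using zero_le_power2[of "g x - c"] by (simp add: power2_eq_square algebra_simps)
  with has_integral_nonneg[OF i]
  have "0 \<le> integral {0..l} (\<lambda>x. (g x)\<^sup>2) - 2 * c * integral {0..l} g + l * c\<^sup>2"
    by simp
  also have "\<dots> = integral {0..l} (\<lambda>x. (g x)\<^sup>2) - (integral {0..l} g)\<^sup>2 / l"
    using l by (simp add: c_def power2_eq_square field_simps)
  finally show ?thesis using l by (simp add: field_simps)
qed

lemma integral_square_diff_const:
  fixes F :: "real \<Rightarrow> real"
  assumes "0 \<le> L" and "continuous_on {0..L} F"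
  shows "integral {0..L} (\<lambda>t. (F t - z)\<^sup>2)
    = integral {0..L} (\<lambda>t. (F t)\<^sup>2) - 2 * z * integral {0..L} F + z\<^sup>2 * L"
proof -
  have i: "F integrable_on {0..L}" "(\<lambda>t. (F t)\<^sup>2) integrable_on {0..L}"
    by (intro integrable_continuous_interval continuous_intros assms(2))+
  have "((\<lambda>t. (F t)\<^sup>2 - 2 * z * F t + z\<^sup>2) has_integral
      integral {0..L} (\<lambda>t. (F t)\<^sup>2) - 2 * z * integral {0..L} F + (L - 0) *\<^sub>R z\<^sup>2) {0..L}"
    using assms(1) has_integral_const_real[of "z\<^sup>2" 0 L]
    by (intro has_integral_add[OF has_integral_diff] has_integral_mult_right integrable_integral i) simp
  moreover have "(\<lambda>t. (F t - z)\<^sup>2) = (\<lambda>t. (F t)\<^sup>2 - 2 * z * F t + z\<^sup>2)"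
    by (simp add: power2_eq_square algebra_simps)
  ultimately show ?thesis by (simp add: integral_unique mult.commute)
qed

section \<open>Distances in the metric realization\<close>

definition edge_point :: "real \<Rightarrow> 'v \<Rightarrow> 'v \<Rightarrow> real \<Rightarrow> 'v \<Rightarrow> real"
  where "edge_point L u v t = (\<lambda>w. if w = u then 1 - t / L else if w = v then t / L else 0)"

definition vertex_point :: "'v \<Rightarrow> 'v \<Rightarrow> real"
  where "vertex_point u = (\<lambda>w. if w = u then 1 else 0)"

lemma edge_point_0: "edge_point L u v 0 = vertex_point u"
  by (auto simp: edge_point_def vertex_point_def)

lemma edge_point_L: "0 < L \<Longrightarrow> u \<noteq> v \<Longrightarrow> edge_point L u v L = vertex_point v"
  by (auto simp: edge_point_def vertex_point_def)

lemma simplex_points_edge: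
  assumes "u \<noteq> v" and "0 < L"
  shows "simplex_points {u, v} = edge_point L u v ` {0..L}"
proof (intro equalityI subsetI)
  fix x assume "x \<in> simplex_points {u, v}"
  then have x: "0 \<le> x u" "0 \<le> x v" "x u + x v = 1" "\<And>w. w \<noteq> u \<Longrightarrow> w \<noteq> v \<Longrightarrow> x w = 0"
    using assms by (auto simp: simplex_points_def)
  have "x = edge_point L u v (L * x v)"
    using x assms by (auto simp: edge_point_def fun_eq_iff)
  moreover have "L * x v \<in> {0..L}" using x assms by (auto simp: mult_le_cancel_left1)
  ultimately show "x \<in> edge_point L u v ` {0..L}" by blast
next
  fix x assume "x \<in> edge_point L u v ` {0..L}"
  then show "x \<in> simplex_points {u, v}"
    using assms by (auto simp: simplex_points_def edge_point_def)
qed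

lemma edge_dist_edge_point:
  assumes "u \<noteq> v" and "0 < l {u, v}"
  shows "edge_dist l {u, v} (edge_point (l {u, v}) u v s) (edge_point (l {u, v}) u v t) = \<bar>s - t\<bar>"
proof -
  have "\<bar>(1 - s / l {u, v}) - (1 - t / l {u, v})\<bar> = \<bar>s - t\<bar> / l {u, v}"
    using assms by (simp add: abs_if field_simps)
  moreover have "\<bar>s / l {u, v} - t / l {u, v}\<bar> = \<bar>s - t\<bar> / l {u, v}"
    using assms by (simp add: diff_divide_distrib[symmetric])
  ultimately show ?thesis using assms by (simp add: edge_dist_def edge_point_def)
qed

lemma vertex_point_in_simplex: "finite e \<Longrightarrow> u \<in> e \<Longrightarrow> vertex_point u \<in> simplex_points e"
  by (auto simp: simplex_points_def vertex_point_def)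

lemma chain_trans:
  "chain E l x y r \<Longrightarrow> \<exists>r'. chain E l y z r' \<Longrightarrow> \<exists>r'. chain E l x z r'"
  by (induction rule: chain.induct) (blast intro: chain_step)+

text \<open>Lower bounds on the gluing metric come from test functions: a function that is
  1-Lipschitz on every edge cannot vary by more than the length of a chain.\<close>

lemma chain_lipschitz:
  assumes "\<And>e x y. e \<in> E \<Longrightarrow> x \<in> simplex_points e \<Longrightarrow> y \<in> simplex_points e
      \<Longrightarrow> \<bar>h x - h y\<bar> \<le> edge_dist l e x y"
  shows "chain E l x y r \<Longrightarrow> \<bar>h x - h y\<bar> \<le> (r :: real)"
proof (induction rule: chain.induct)
  case (chain_step e x y z r)
  then show ?case using assms[of e x y] by linarith
qed simp

section \<open>Graphs with edge lengths and estimates of their gluing metric\<close>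

locale length_graph =
  fixes V :: "'v set" and E :: "'v set set" and l :: "'v set \<Rightarrow> real"
  assumes simple: "simple_graph V E" and connected: "connected_graph V E"
    and length_pos: "e \<in> E \<Longrightarrow> 0 < l e"
begin

lemma edge_subset: "e \<in> E \<Longrightarrow> e \<subseteq> V" and card_edge: "e \<in> E \<Longrightarrow> card e = 2"
  and finite_V: "finite V"
  using simple by (auto simp: simple_graph_def)

lemma finite_edge: "e \<in> E \<Longrightarrow> finite e"
  using card_edge by (fastforce intro: card_ge_0_finite)

lemma finite_E: "finite E"
  using edge_subset finite_V by (auto intro: finite_subset[of E "Pow V"])

lemma edge_ends:
  assumes "e \<in> E"
  obtains u v where "e = {u, v}" "u \<noteq> v"
  using card_edge[OF assms] by (auto simp: card_2_iff)

lemma edge_dist_nonneg: "e \<in> E \<Longrightarrow> 0 \<le> edge_dist l e x y"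
  using length_pos[of e] by (auto simp: edge_dist_def intro!: mult_nonneg_nonneg sum_nonneg)

lemma chain_nonneg: "chain E l x y r \<Longrightarrow> 0 \<le> r"
  by (induction rule: chain.induct) (simp_all add: edge_dist_nonneg)

lemma chain_in_edge:
  "e \<in> E \<Longrightarrow> x \<in> simplex_points e \<Longrightarrow> y \<in> simplex_points e \<Longrightarrow> chain E l x y (edge_dist l e x y)"
  using chain_step[of e E x y l y 0] chain_refl by force

lemma realization_dist_le:
  assumes "e \<in> E" "x \<in> simplex_points e" "y \<in> simplex_points e"
  shows "realization_dist E l x y \<le> edge_dist l e x y"
  unfolding realization_dist_def using assms
  by (intro cInf_lower bdd_belowI[of _ 0]) (auto intro: chain_nonneg chain_in_edge)

lemma chain_vertices:
  assumes "u \<in> V" "v \<in> V"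
  shows "\<exists>r. chain E l (vertex_point u) (vertex_point v) r"
proof -
  have "(u, v) \<in> {(a, b). {a, b} \<in> E}\<^sup>*"
    using connected assms by (auto simp: connected_graph_def)
  then show ?thesis
  proof (induction rule: converse_rtrancl_induct)
    case base
    then show ?case by (blast intro: chain_refl)
  next
    case (step y z)
    then have e: "{y, z} \<in> E" by simp
    have "chain E l (vertex_point y) (vertex_point z)
        (edge_dist l {y, z} (vertex_point y) (vertex_point z))"
      using e by (intro chain_in_edge) (auto intro: vertex_point_in_simplex)
    then show ?case using step.IH by (rule chain_trans)
  qed
qed

text \<open>Connectedness enters the metric here: the set whose infimum is the distance is nonempty,
  so a bound for all chains bounds the distance.\<close>

lemma chain_exists:
  assumes "e \<in> E" "x \<in> simplex_points e" "e' \<in> E" "y \<in> simplex_points e'"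
  shows "\<exists>r. chain E l x y r"
proof -
  obtain u u' where u: "u \<in> e" "u' \<in> e'" using assms edge_ends by (metis insertI1)
  show ?thesis
  proof (rule chain_trans[OF chain_in_edge])
    show "e \<in> E" "x \<in> simplex_points e" by fact+
    show "vertex_point u \<in> simplex_points e"
      using u assms finite_edge by (auto intro: vertex_point_in_simplex)
    obtain r where "chain E l (vertex_point u) (vertex_point u') r"
      using chain_vertices[of u u'] u assms edge_subset by blast
    then show "\<exists>r. chain E l (vertex_point u) y r"
    proof (rule chain_trans)
      show "\<exists>r. chain E l (vertex_point u') y r"
        using chain_in_edge[of e' "vertex_point u'" y] u assms finite_edge
        by (blast intro: vertex_point_in_simplex)
    qed
  qed
qed

text \<open>The distance to an interior point of an edge, cut off where it would reach an end of that
  edge, is a Lipschitz function on the whole realization.\<close>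

lemma realization_dist_ge:
  assumes e: "{u, v} \<in> E" "u \<noteq> v" and s: "0 < s" "s < l {u, v}"
    and e': "e' \<in> E" "y \<in> simplex_points e'"
  defines "p \<equiv> edge_point (l {u, v}) u v s" and "\<delta> \<equiv> min s (l {u, v} - s)"
  shows "(if y \<in> simplex_points {u, v} then min (edge_dist l {u, v} p y) \<delta> else \<delta>)
    \<le> realization_dist E l p y"
proof -
  let ?e = "{u, v}" and ?L = "l {u, v}"
  define h where "h x = (if x \<in> simplex_points ?e then min (edge_dist l ?e p x) \<delta> else \<delta>)" for x
  have L: "0 < ?L" using length_pos e by blast
  note sp = simplex_points_edge[OF e(2) L]
  note ed = edge_dist_edge_point[where l = l, OF e(2) L]
  have p: "p \<in> simplex_points ?e" using s by (auto simp: sp p_def)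
  have lip: "\<bar>h x - h y\<bar> \<le> edge_dist l e'' x y"
    if *: "e'' \<in> E" "x \<in> simplex_points e''" "y \<in> simplex_points e''" for e'' x y
  proof (cases "e'' = ?e")
    case True
    then obtain t r where "x = edge_point ?L u v t" "y = edge_point ?L u v r"
      using * sp by auto
    then show ?thesis using True * by (simp add: h_def p_def ed)
  next
    case False
    have "h z = \<delta>" if z: "z \<in> simplex_points e''" for z
    proof (cases "z \<in> simplex_points ?e")
      case True
      then obtain t where t: "z = edge_point ?L u v t" using sp by auto
      \<comment> \<open>Two distinct edges of a simple graph share at most one vertex, so a common
        point is an end of \<open>{u, v}\<close>, where the test function has already reached the
        cutoff \<delta>.\<close>
      have "u \<notin> e'' \<or> v \<notin> e''"
      proof (rule ccontr)
        assume "\<not> (u \<notin> e'' \<or> v \<notin> e'')"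
        then have "?e = e''"
          using card_edge[OF *(1)] e(2) finite_edge[OF *(1)] by (intro card_subset_eq) auto
        with False show False by simp
      qed
      then have "z u = 0 \<or> z v = 0" using z by (auto simp: simplex_points_def)
      then have "t = ?L \<or> t = 0" using L e(2) by (auto simp: t edge_point_def)
      then show ?thesis using s True by (auto simp: h_def p_def t ed \<delta>_def min_def)
    qed (simp add: h_def)
    moreover have "0 \<le> edge_dist l e'' x y" using *(1) by (rule edge_dist_nonneg)
    ultimately show ?thesis using * by simp
  qed
  have hp: "h p = 0" using p s by (simp add: h_def p_def ed \<delta>_def)
  have "h y \<le> realization_dist E l p y"
    unfolding realization_dist_def
  proof (rule cInf_greatest)
    show "{r. chain E l p y r} \<noteq> {}" using chain_exists[OF e(1) p e'] by blast
    fix r assume "r \<in> {r. chain E l p y r}"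
    then have "\<bar>h p - h y\<bar> \<le> r" using chain_lipschitz[of E h l p y r] lip by blast
    then show "h y \<le> r" using hp by simp
  qed
  then show ?thesis by (simp add: h_def)
qed

text \<open>The cutoff reflects shortcuts: when the ends of an edge are joined by a shorter path,
  leaving through one end and returning through the other may be quicker than staying on the
  edge.\<close>

lemma realization_dist_ge_same_edge:
  assumes "{u, v} \<in> E" "u \<noteq> v" "0 < s" "s < l {u, v}" "0 \<le> t" "t \<le> l {u, v}"
  shows "min \<bar>s - t\<bar> (min s (l {u, v} - s))
    \<le> realization_dist E l (edge_point (l {u, v}) u v s) (edge_point (l {u, v}) u v t)"
proof -
  have "edge_point (l {u, v}) u v t \<in> simplex_points {u, v}"
    using assms simplex_points_edge[OF assms(2) length_pos[OF assms(1)]] by auto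
  then show ?thesis
    using realization_dist_ge[OF assms(1-4) assms(1)] edge_dist_edge_point[where l = l, OF assms(2) length_pos[OF assms(1)]]
    by fastforce
qed

lemma realization_dist_ge_other_edge:
  assumes "{u, v} \<in> E" "u \<noteq> v" "0 < s" "s < l {u, v}"
    and "e' \<in> E" "e' \<noteq> {u, v}" "y \<in> simplex_points e'"
  shows "min s (l {u, v} - s) \<le> realization_dist E l (edge_point (l {u, v}) u v s) y"
proof (cases "y \<in> simplex_points {u, v}")
  case False
  then show ?thesis using realization_dist_ge[OF assms(1-5) assms(7)] by simp
next
  case True
  have L: "0 < l {u, v}" using length_pos assms by blast
  obtain t where t: "y = edge_point (l {u, v}) u v t" "0 \<le> t" "t \<le> l {u, v}"
    using True simplex_points_edge[OF assms(2) L] by auto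
  have "u \<notin> e' \<or> v \<notin> e'"
  proof (rule ccontr)
    assume "\<not> (u \<notin> e' \<or> v \<notin> e')"
    then have "{u, v} = e'"
      using card_edge[OF assms(5)] assms(2) finite_edge[OF assms(5)] by (intro card_subset_eq) auto
    with assms(6) show False by simp
  qed
  then have "y u = 0 \<or> y v = 0" using assms by (auto simp: simplex_points_def)
  then have "t = l {u, v} \<or> t = 0" using L assms(2) by (auto simp: t edge_point_def)
  then show ?thesis
    using realization_dist_ge_same_edge[OF assms(1-4) t(2,3)] assms(3,4)
    by (auto simp: t min_def split: if_splits)
qed

lemma vertex_in_edge:
  assumes "card V \<ge> 2" and "v \<in> V"
  shows "\<exists>e\<in>E. v \<in> e"
proof -
  obtain u where u: "u \<in> V" "u \<noteq> v"
  proof -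
    have "\<not> card V \<le> Suc 0" using assms by simp
    then obtain a b where "a \<in> V" "b \<in> V" "a \<noteq> b"
      unfolding card_le_Suc0_iff_eq[OF finite_V] by blast
    then show ?thesis using that by metis
  qed
  have "(v, u) \<in> {(a, b). {a, b} \<in> E}\<^sup>*"
    using connected assms u by (auto simp: connected_graph_def)
  then show ?thesis using u(2) by (cases rule: converse_rtranclE) auto
qed

lemma realization_edges:
  assumes "card V \<ge> 2"
  shows "realization V E = (\<Union>e\<in>E. simplex_points e)"
proof -
  have "simplex_points {v} \<subseteq> (\<Union>e\<in>E. simplex_points e)" if "v \<in> V" for v
  proof -
    obtain e where e: "e \<in> E" "v \<in> e" using vertex_in_edge[OF assms \<open>v \<in> V\<close>] by blast
    have "x = vertex_point v" if "x \<in> simplex_points {v}" for x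
      using that by (auto simp: simplex_points_def vertex_point_def)
    then have "simplex_points {v} \<subseteq> {vertex_point v}" by blast
    moreover have "vertex_point v \<in> simplex_points e"
      using e finite_edge by (intro vertex_point_in_simplex)
    ultimately show ?thesis using e(1) by blast
  qed
  then show ?thesis by (auto simp: realization_def)
qed

end

section \<open>Integration along a subdivision and along the edges\<close>

text \<open>All that the integration needs of a metric graph: each chart is non-expanding, it is
  isometric near interior points, and an interior point keeps its distance from other edges. The
  gluing at the ends is not recorded.\<close>

locale charted_graph = Metric_space M d
  for M :: "'a set" and d :: "'a \<Rightarrow> 'a \<Rightarrow> real" +
  fixes E :: "'e set" and len :: "'e \<Rightarrow> real" and c :: "'e \<Rightarrow> real \<Rightarrow> 'a"
  assumes finite_edges: "finite E"
    and len_pos: "e \<in> E \<Longrightarrow> 0 < len e"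
    and carrier_eq: "M = (\<Union>e\<in>E. c e ` {0..len e})"
    and chart_dist_le: "e \<in> E \<Longrightarrow> s \<in> {0..len e} \<Longrightarrow> t \<in> {0..len e} \<Longrightarrow> d (c e s) (c e t) \<le> \<bar>s - t\<bar>"
    and chart_dist_ge: "e \<in> E \<Longrightarrow> s \<in> {0<..<len e} \<Longrightarrow> t \<in> {0..len e}
      \<Longrightarrow> min \<bar>s - t\<bar> (min s (len e - s)) \<le> d (c e s) (c e t)"
    and chart_dist_ge_other: "e \<in> E \<Longrightarrow> e' \<in> E \<Longrightarrow> e \<noteq> e' \<Longrightarrow> s \<in> {0<..<len e}
      \<Longrightarrow> t \<in> {0..len e'} \<Longrightarrow> min s (len e - s) \<le> d (c e s) (c e' t)"
begin

lemma chart_in_carrier: "e \<in> E \<Longrightarrow> s \<in> {0..len e} \<Longrightarrow> c e s \<in> M"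
  unfolding carrier_eq by blast

text \<open>Both lower distance bounds are positive at an interior point, so such a point determines
  its edge and its coordinate.\<close>

lemma chart_eq:
  assumes "e \<in> E" "e' \<in> E" "s \<in> {0<..<len e}" "t \<in> {0..len e'}" "c e s = c e' t"
  shows "e' = e \<and> t = s"
proof -
  have "d (c e s) (c e' t) = 0"
    using assms chart_in_carrier[of e' t] by simp
  then show ?thesis
    using chart_dist_ge[of e s t] chart_dist_ge_other[of e e' s t] assms
    by (cases "e = e'") (auto simp: min_def split: if_splits)
qed

lemma chart_inj: "e \<in> E \<Longrightarrow> inj_on (c e) {0<..<len e}"
  by (rule inj_onI) (use chart_eq in fastforce)

section \<open>Segments of the space seen in edge charts\<close>

lemma segment_local_isometry:
  assumes "segment M d (L, \<gamma>)" and "t \<in> {0..L}"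
  obtains \<epsilon> where "0 < \<epsilon>" "\<And>r s. r \<in> {0..L} \<Longrightarrow> s \<in> {0..L} \<Longrightarrow> \<bar>r - t\<bar> < \<epsilon> \<Longrightarrow> \<bar>s - t\<bar> < \<epsilon>
      \<Longrightarrow> d (\<gamma> r) (\<gamma> s) = \<bar>r - s\<bar>"
proof -
  have "\<forall>t\<in>{0..L}. \<exists>\<epsilon>>0. \<forall>r\<in>{0..L}. \<forall>s\<in>{0..L}.
      \<bar>r - t\<bar> < \<epsilon> \<and> \<bar>s - t\<bar> < \<epsilon> \<longrightarrow> d (\<gamma> r) (\<gamma> s) = \<bar>r - s\<bar>"
    using assms(1) by (simp add: segment_def)
  then obtain \<epsilon> where "\<epsilon> > 0" "\<forall>r\<in>{0..L}. \<forall>s\<in>{0..L}.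
      \<bar>r - t\<bar> < \<epsilon> \<and> \<bar>s - t\<bar> < \<epsilon> \<longrightarrow> d (\<gamma> r) (\<gamma> s) = \<bar>r - s\<bar>"
    using assms(2) by blast
  then show ?thesis using that by blast
qed

lemma segment_dist_continuous:
  assumes "segment M d (L, \<gamma>)" and x: "x \<in> M"
  shows "continuous_on {0..L} (\<lambda>t. d x (\<gamma> t))"
  unfolding continuous_on_iff
proof (intro ballI allI impI)
  fix t \<epsilon> :: real
  assume t: "t \<in> {0..L}" and \<epsilon>: "0 < \<epsilon>"
  obtain \<eta> where \<eta>: "\<eta> > 0" "\<And>r s. r \<in> {0..L} \<Longrightarrow> s \<in> {0..L} \<Longrightarrow> \<bar>r - t\<bar> < \<eta> \<Longrightarrow> \<bar>s - t\<bar> < \<eta>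
      \<Longrightarrow> d (\<gamma> r) (\<gamma> s) = \<bar>r - s\<bar>"
    using segment_local_isometry[OF assms(1) t] by blast
  have in_M: "\<gamma> r \<in> M" if "r \<in> {0..L}" for r using assms that by (auto simp: segment_def)
  show "\<exists>\<delta>>0. \<forall>t'\<in>{0..L}. dist t' t < \<delta> \<longrightarrow> dist (d x (\<gamma> t')) (d x (\<gamma> t)) < \<epsilon>"
  proof (intro exI[of _ "min \<eta> \<epsilon>"] conjI ballI impI)
    fix r assume r: "r \<in> {0..L}" "dist r t < min \<eta> \<epsilon>"
    then have "d (\<gamma> r) (\<gamma> t) = \<bar>r - t\<bar>" using \<eta> t by (auto simp: dist_real_def)
    moreover have "d x (\<gamma> r) \<le> d x (\<gamma> t) + d (\<gamma> t) (\<gamma> r)" "d x (\<gamma> t) \<le> d x (\<gamma> r) + d (\<gamma> r) (\<gamma> t)"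
      using triangle in_M r t x by auto
    ultimately show "dist (d x (\<gamma> r)) (d x (\<gamma> t)) < \<epsilon>"
      using r commute[of "\<gamma> t" "\<gamma> r"] by (auto simp: dist_real_def)
  qed (use \<eta> \<epsilon> in auto)
qed

text \<open>Works because the segments are compact and finite in number.\<close>

lemma continuous_of_segments:
  assumes S: "finite S" "\<And>L \<gamma>. (L, \<gamma>) \<in> S \<Longrightarrow> segment M d (L, \<gamma>)"
    and cover: "M \<subseteq> (\<Union>(L, \<gamma>)\<in>S. \<gamma> ` {0..L})"
    and cont: "\<And>L \<gamma>. (L, \<gamma>) \<in> S \<Longrightarrow> continuous_on {0..L} (f \<circ> \<gamma>)"
    and x: "x \<in> M" and \<epsilon>: "0 < (\<epsilon> :: real)"
  shows "\<exists>\<delta>>0. \<forall>y\<in>M. d x y < \<delta> \<longrightarrow> \<bar>f y - f x\<bar> < \<epsilon>"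
proof -
  have "\<exists>\<delta>>0. \<forall>t\<in>{0..L}. d x (\<gamma> t) < \<delta> \<longrightarrow> \<bar>f (\<gamma> t) - f x\<bar> < \<epsilon>" if s: "(L, \<gamma>) \<in> S" for L \<gamma>
  proof -
    \<comment> \<open>The bad parameters form a compact set that avoids \<open>x\<close>, so their
      distance from \<open>x\<close> has a positive minimum. That minimum serves as \<delta> for
      this segment, whether or not the segment passes through \<open>x\<close>.\<close>
    define C where "C = {t\<in>{0..L}. \<epsilon> \<le> \<bar>(f \<circ> \<gamma>) t - f x\<bar>}"
    have not_C: "\<bar>f (\<gamma> t) - f x\<bar> < \<epsilon>" if "t \<in> {0..L}" "t \<notin> C" for t
      using that by (simp add: C_def not_le)
    have "closed C"
      unfolding C_def by (intro continuous_on_closed_Collect_le continuous_intros cont[OF s])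
    moreover have "bounded C" by (rule bounded_subset[of "{0..L}"]) (auto simp: C_def)
    ultimately have C: "compact C" by (simp add: compact_eq_bounded_closed)
    have pos: "0 < d x (\<gamma> t)" if "t \<in> C" for t
    proof -
      have "\<gamma> t \<in> M" using that S(2)[OF s] by (auto simp: C_def segment_def)
      moreover have "\<gamma> t \<noteq> x" using that \<epsilon> by (auto simp: C_def)
      ultimately show ?thesis using x by simp
    qed
    show ?thesis
    proof (cases "C = {}")
      case True
      then show ?thesis using not_C by (intro exI[of _ 1]) simp
    next
      case False
      have "continuous_on C (\<lambda>t. d x (\<gamma> t))"
        using segment_dist_continuous[OF S(2)[OF s] x] by (rule continuous_on_subset) (auto simp: C_def)
      then obtain t0 where t0: "t0 \<in> C" "\<And>t. t \<in> C \<Longrightarrow> d x (\<gamma> t0) \<le> d x (\<gamma> t)"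
        using continuous_attains_inf[OF C False] by blast
      then show ?thesis
        using pos[OF t0(1)] not_C by (intro exI[of _ "d x (\<gamma> t0)"]) (meson not_le)
    qed
  qed
  then have "\<forall>s\<in>S. \<exists>\<delta>>0. \<forall>t\<in>{0..fst s}. d x (snd s t) < \<delta> \<longrightarrow> \<bar>f (snd s t) - f x\<bar> < \<epsilon>" by auto
  then obtain \<delta> where \<delta>: "\<And>s. s \<in> S \<Longrightarrow> 0 < \<delta> s"
    "\<And>s t. s \<in> S \<Longrightarrow> t \<in> {0..fst s} \<Longrightarrow> d x (snd s t) < \<delta> s \<Longrightarrow> \<bar>f (snd s t) - f x\<bar> < \<epsilon>"
    by metis
  show ?thesis
  proof (intro exI[of _ "Min (insert 1 (\<delta> ` S))"] conjI ballI impI)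
    show "0 < Min (insert 1 (\<delta> ` S))" using S(1) \<delta>(1) by simp
    fix y assume y: "y \<in> M" "d x y < Min (insert 1 (\<delta> ` S))"
    then obtain s t where s: "s \<in> S" "t \<in> {0..fst s}" "y = snd s t" using cover by fastforce
    then have "d x y < \<delta> s" using y(2) S(1) by simp
    then show "\<bar>f y - f x\<bar> < \<epsilon>" using \<delta>(2)[OF s(1,2)] s(3) by simp
  qed
qed

lemma continuous_along_chart:
  assumes "\<And>x \<epsilon>. x \<in> M \<Longrightarrow> 0 < (\<epsilon> :: real) \<Longrightarrow> \<exists>\<delta>>0. \<forall>y\<in>M. d x y < \<delta> \<longrightarrow> \<bar>f y - f x\<bar> < \<epsilon>"
    and e: "e \<in> E"
  shows "continuous_on {0..len e} (f \<circ> c e)"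
  unfolding continuous_on_iff
proof (intro ballI allI impI)
  fix t \<epsilon> :: real assume t: "t \<in> {0..len e}" and "0 < \<epsilon>"
  then obtain \<delta> where \<delta>: "\<delta> > 0" "\<And>y. y \<in> M \<Longrightarrow> d (c e t) y < \<delta> \<Longrightarrow> \<bar>f y - f (c e t)\<bar> < \<epsilon>"
    using assms(1)[OF chart_in_carrier[OF e t]] by blast
  show "\<exists>\<delta>>0. \<forall>t'\<in>{0..len e}. dist t' t < \<delta> \<longrightarrow> dist ((f \<circ> c e) t') ((f \<circ> c e) t) < \<epsilon>"
  proof (intro exI[of _ \<delta>] conjI ballI impI)
    fix r assume r: "r \<in> {0..len e}" "dist r t < \<delta>"
    then have "d (c e t) (c e r) < \<delta>" using chart_dist_le[OF e t r(1)] by (simp add: dist_real_def)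
    then show "dist ((f \<circ> c e) r) ((f \<circ> c e) t) < \<epsilon>"
      using \<delta>(2) chart_in_carrier[OF e r(1)] by (simp add: dist_real_def)
  qed (rule \<delta>(1))
qed

text \<open>Near an interior point of an edge the segment stays on that edge, its coordinate is a
  distance-preserving map of an interval, and such a map is a translation or a reflection.\<close>

lemma segment_locally_affine:
  assumes seg: "segment M d (L, \<gamma>)" and e: "e \<in> E"
    and t: "t \<in> {0<..<L}" and s: "s \<in> {0<..<len e}" and ts: "\<gamma> t = c e s"
  obtains \<eta> \<sigma> where "0 < \<eta>" "\<bar>\<sigma>\<bar> = 1"
    and "\<And>r. \<bar>r - t\<bar> < \<eta> \<Longrightarrow> r \<in> {0<..<L} \<and> s + \<sigma> * (r - t) \<in> {0<..<len e} \<and> \<gamma> r = c e (s + \<sigma> * (r - t))"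
proof -
  obtain \<epsilon> where \<epsilon>: "\<epsilon> > 0" "\<And>r q. r \<in> {0..L} \<Longrightarrow> q \<in> {0..L} \<Longrightarrow> \<bar>r - t\<bar> < \<epsilon> \<Longrightarrow> \<bar>q - t\<bar> < \<epsilon>
      \<Longrightarrow> d (\<gamma> r) (\<gamma> q) = \<bar>r - q\<bar>"
    using segment_local_isometry[OF seg, of t] t by (metis atLeastAtMost_iff greaterThanLessThan_iff less_imp_le)
  have in_M: "\<gamma> r \<in> M" if "r \<in> {0..L}" for r using seg that by (auto simp: segment_def)
  define \<delta> where "\<delta> = min s (len e - s)"
  \<comment> \<open>With \<open>4 * \<eta> \<le> \<delta>\<close>, all coordinates that occur are
    more than \<open>2 * \<eta>\<close> from the ends of the edge, while two parameters differ by
    less than that. Hence the cutoff in \<open>chart_dist_ge\<close> is never the smaller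
    term.\<close>
  define \<eta> where "\<eta> = min (min \<epsilon> (min t (L - t))) (\<delta> / 4)"
  have \<delta>: "\<delta> > 0" using s by (auto simp: \<delta>_def)
  have \<eta>: "\<eta> > 0" "\<eta> \<le> \<epsilon>" "\<eta> \<le> t" "\<eta> \<le> L - t" "4 * \<eta> \<le> \<delta>"
    using \<epsilon>(1) \<delta> t by (auto simp: \<eta>_def min_def)
  have ran: "r \<in> {0<..<L}" if "\<bar>r - t\<bar> < \<eta>" for r using that \<eta> by auto
  have "\<exists>x\<in>{0<..<len e}. \<gamma> r = c e x \<and> \<bar>x - s\<bar> = \<bar>r - t\<bar>" if r: "\<bar>r - t\<bar> < \<eta>" for r
  proof -
    have rL: "r \<in> {0..L}" "t \<in> {0..L}" using ran[OF r] t by auto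
    have dr: "d (c e s) (\<gamma> r) = \<bar>r - t\<bar>"
      using \<epsilon>(2)[OF rL(2,1)] r \<eta> \<epsilon>(1) ts by (simp add: abs_minus_commute)
    then have small: "d (c e s) (\<gamma> r) < \<delta>" using r \<eta> \<delta> by linarith
    obtain e' x where x: "e' \<in> E" "x \<in> {0..len e'}" "\<gamma> r = c e' x"
      using in_M[OF rL(1)] unfolding carrier_eq by auto
    have "e' = e"
      using chart_dist_ge_other[OF e x(1) _ s x(2)] small x(3) by (force simp: \<delta>_def)
    with x have x: "x \<in> {0..len e}" "\<gamma> r = c e x" by auto
    have "min \<bar>s - x\<bar> \<delta> \<le> \<bar>r - t\<bar>" "\<bar>r - t\<bar> \<le> \<bar>s - x\<bar>"
      using chart_dist_ge[OF e s x(1)] chart_dist_le[OF e _ x(1), of s] s dr x(2)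
      by (auto simp: \<delta>_def)
    then have xs: "\<bar>x - s\<bar> = \<bar>r - t\<bar>" using r \<eta> \<delta> by (auto simp: min_def split: if_splits)
    then have "\<bar>x - s\<bar> < \<delta>" using r \<eta> \<delta> by linarith
    then have "x \<in> {0<..<len e}" by (auto simp: \<delta>_def)
    with x xs show ?thesis by blast
  qed
  then obtain \<tau> where \<tau>: "\<And>r. \<bar>r - t\<bar> < \<eta> \<Longrightarrow> \<tau> r \<in> {0<..<len e}"
    "\<And>r. \<bar>r - t\<bar> < \<eta> \<Longrightarrow> \<gamma> r = c e (\<tau> r)" "\<And>r. \<bar>r - t\<bar> < \<eta> \<Longrightarrow> \<bar>\<tau> r - s\<bar> = \<bar>r - t\<bar>"
    by metis
  have iso: "\<bar>\<tau> r - \<tau> q\<bar> = \<bar>r - q\<bar>" if r: "\<bar>r - t\<bar> < \<eta>" and q: "\<bar>q - t\<bar> < \<eta>" for r q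
  proof -
    have rq: "r \<in> {0..L}" "q \<in> {0..L}" using ran[OF r] ran[OF q] by auto
    have D: "d (c e (\<tau> r)) (c e (\<tau> q)) = \<bar>r - q\<bar>"
      using \<epsilon>(2)[OF rq] r q \<eta>(2) \<tau>(2) by simp
    have "min (\<tau> r) (len e - \<tau> r) > 2 * \<eta>"
      using \<tau>(3)[OF r] r \<eta>(5) by (auto simp: \<delta>_def)
    moreover have "\<bar>r - q\<bar> < 2 * \<eta>" using r q by linarith
    moreover have "min \<bar>\<tau> r - \<tau> q\<bar> (min (\<tau> r) (len e - \<tau> r)) \<le> \<bar>r - q\<bar>"
      "\<bar>r - q\<bar> \<le> \<bar>\<tau> r - \<tau> q\<bar>"
      using chart_dist_ge[OF e \<tau>(1)[OF r], of "\<tau> q"] chart_dist_le[OF e, of "\<tau> r" "\<tau> q"]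
        \<tau>(1)[OF r] \<tau>(1)[OF q] D by auto
    ultimately show ?thesis by (auto simp: min_def split: if_splits)
  qed
  \<comment> \<open>The image of one point besides \<open>t\<close> determines the isometry:
    \<open>q\<close> decides between slope 1 and slope -1 for all parameters at once.\<close>
  define q where "q = t + \<eta> / 2"
  define \<sigma> where "\<sigma> = (if \<tau> q = s + \<eta> / 2 then 1 else - 1 :: real)"
  have q: "\<bar>q - t\<bar> < \<eta>" "q - t = \<eta> / 2" using \<eta> by (auto simp: q_def)
  have \<tau>q: "\<tau> q = s + \<sigma> * (\<eta> / 2)" using \<tau>(3)[OF q(1)] q(2) \<eta>(1) by (auto simp: \<sigma>_def abs_if split: if_splits)
  have \<tau>r: "\<tau> r = s + \<sigma> * (r - t)" if r: "\<bar>r - t\<bar> < \<eta>" for r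
  proof -
    have 1: "\<tau> r - s = r - t \<or> \<tau> r - s = - (r - t)"
      using \<tau>(3)[OF r] by (simp only: abs_eq_iff)
    have 2: "\<tau> r - \<tau> q = r - q \<or> \<tau> r - \<tau> q = - (r - q)"
      using iso[OF r q(1)] by (simp only: abs_eq_iff)
    show ?thesis
    proof (cases "\<sigma> = 1")
      case True
      then show ?thesis using 1 2 \<tau>q q(2) \<eta>(1) by (elim disjE) simp_all
    next
      case False
      then have "\<sigma> = - 1" by (simp add: \<sigma>_def split: if_splits)
      then show ?thesis using 1 2 \<tau>q q(2) \<eta>(1) by (elim disjE) simp_all
    qed
  qed
  have "\<bar>\<sigma>\<bar> = 1" by (simp add: \<sigma>_def)
  from that[OF \<eta>(1) this] show ?thesis using \<tau>(1,2) \<tau>r ran by metis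
qed

text \<open>An inverse of the chart on the open edge only. At the ends the chart need not be
  injective together with the other edges, and no value is claimed there.\<close>

definition chart_coord :: "'e \<Rightarrow> 'a \<Rightarrow> real"
  where "chart_coord e x = the_inv_into {0<..<len e} (c e) x"

lemma chart_coord: "e \<in> E \<Longrightarrow> s \<in> {0<..<len e} \<Longrightarrow> chart_coord e (c e s) = s"
  unfolding chart_coord_def by (intro the_inv_into_f_f chart_inj)

text \<open>The ends of both the segment and the edge are excluded, which makes the set open and the
  edge coordinate locally affine on it.\<close>

definition edge_times :: "real \<times> (real \<Rightarrow> 'a) \<Rightarrow> 'e \<Rightarrow> real set"
  where "edge_times = (\<lambda>(L, \<gamma>) e. {t\<in>{0<..<L}. \<gamma> t \<in> c e ` {0<..<len e}})"

lemma edge_times_chart_coord: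
  assumes "e \<in> E" and "t \<in> edge_times (L, \<gamma>) e"
  shows "chart_coord e (\<gamma> t) \<in> {0<..<len e}" and "c e (chart_coord e (\<gamma> t)) = \<gamma> t"
  using assms by (auto simp: edge_times_def chart_coord)

lemma edge_times_locally_affine:
  assumes seg: "segment M d (L, \<gamma>)" and e: "e \<in> E" and t: "t \<in> edge_times (L, \<gamma>) e"
  obtains \<eta> \<sigma> where "0 < \<eta>" "\<bar>\<sigma>\<bar> = 1"
    and "\<And>r. \<bar>r - t\<bar> < \<eta> \<Longrightarrow> r \<in> edge_times (L, \<gamma>) e \<and> chart_coord e (\<gamma> r) = chart_coord e (\<gamma> t) + \<sigma> * (r - t)"
proof -
  have "t \<in> {0<..<L}" using t by (simp add: edge_times_def)
  from segment_locally_affine[OF seg e this edge_times_chart_coord(1)[OF e t] edge_times_chart_coord(2)[OF e t, symmetric]]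
  obtain \<eta> \<sigma> where *: "0 < \<eta>" "\<bar>\<sigma>\<bar> = 1" "\<And>r. \<bar>r - t\<bar> < \<eta> \<Longrightarrow> r \<in> {0<..<L} \<and>
      chart_coord e (\<gamma> t) + \<sigma> * (r - t) \<in> {0<..<len e} \<and>
      \<gamma> r = c e (chart_coord e (\<gamma> t) + \<sigma> * (r - t))" by blast
  show ?thesis
  proof (rule that[OF *(1,2)])
    fix r assume "\<bar>r - t\<bar> < \<eta>"
    from *(3)[OF this] show "r \<in> edge_times (L, \<gamma>) e \<and>
        chart_coord e (\<gamma> r) = chart_coord e (\<gamma> t) + \<sigma> * (r - t)"
      by (auto simp: edge_times_def chart_coord[OF e])
  qed
qed

lemma open_edge_times:
  assumes "segment M d (L, \<gamma>)" and "e \<in> E"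
  shows "open (edge_times (L, \<gamma>) e)"
  unfolding open_dist
proof
  fix t assume "t \<in> edge_times (L, \<gamma>) e"
  from edge_times_locally_affine[OF assms this]
  show "\<exists>\<eta>>0. \<forall>r. dist r t < \<eta> \<longrightarrow> r \<in> edge_times (L, \<gamma>) e"
    unfolding dist_real_def by metis
qed

lemma chart_coord_inj:
  assumes "segment M d (L, \<gamma>)" and "e \<in> E"
  shows "inj_on (\<lambda>t. chart_coord e (\<gamma> t)) (edge_times (L, \<gamma>) e)"
proof (rule inj_onI)
  fix r t assume rt: "r \<in> edge_times (L, \<gamma>) e" "t \<in> edge_times (L, \<gamma>) e"
    "chart_coord e (\<gamma> r) = chart_coord e (\<gamma> t)"
  then have "\<gamma> r = \<gamma> t" using edge_times_chart_coord(2)[OF assms(2)] by metis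
  moreover have "r \<in> {0..L}" "t \<in> {0..L}" using rt by (auto simp: edge_times_def)
  moreover have "inj_on \<gamma> {0..L}" using assms(1) by (simp add: segment_def)
  ultimately show "r = t" by (blast dest: inj_onD)
qed

lemma chart_coord_derivative:
  assumes "segment M d (L, \<gamma>)" and "e \<in> E" and "t \<in> edge_times (L, \<gamma>) e"
  shows "\<exists>\<sigma>. \<bar>\<sigma>\<bar> = 1 \<and> ((\<lambda>t. chart_coord e (\<gamma> t)) has_real_derivative \<sigma>) (at t) \<and>
    (\<forall>f g'. ((f \<circ> \<gamma>) has_real_derivative g') (at t)
      \<longrightarrow> ((f \<circ> c e) has_real_derivative \<sigma> * g') (at (chart_coord e (\<gamma> t))))"
proof -
  obtain \<eta> \<sigma> where *: "0 < \<eta>" "\<bar>\<sigma>\<bar> = 1" "\<And>r. \<bar>r - t\<bar> < \<eta> \<Longrightarrow> r \<in> edge_times (L, \<gamma>) e \<and>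
      chart_coord e (\<gamma> r) = chart_coord e (\<gamma> t) + \<sigma> * (r - t)"
    using edge_times_locally_affine[OF assms] by blast
  let ?s = "chart_coord e (\<gamma> t)"
  have \<sigma>: "\<sigma> * \<sigma> = 1" using *(2) by (metis abs_mult_self_eq mult_1)
  have near: "\<forall>\<^sub>F r in nhds t. \<bar>r - t\<bar> < \<eta>"
    using *(1) eventually_nhds_metric[of _ t] by (auto simp: dist_real_def)
  have affine: "((\<lambda>r. ?s + \<sigma> * (r - t)) has_real_derivative \<sigma>) (at t)"
    by (auto intro!: derivative_eq_intros)
  have ev: "\<forall>\<^sub>F r in nhds t. chart_coord e (\<gamma> r) = ?s + \<sigma> * (r - t)"
    using near by (rule eventually_mono) (blast dest: *(3))
  have 1: "((\<lambda>t. chart_coord e (\<gamma> t)) has_real_derivative \<sigma>) (at t)"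
    using affine by (rule DERIV_cong_ev[OF refl ev refl, THEN iffD2])
  have 2: "((f \<circ> c e) has_real_derivative \<sigma> * g') (at ?s)"
    if g': "((f \<circ> \<gamma>) has_real_derivative g') (at t)" for f g'
  proof -
    \<comment> \<open>The local inverse of an affine map of slope \<sigma> has the same slope, since
      \<open>\<sigma> * \<sigma> = 1\<close>.\<close>
    have "((\<lambda>x. t + \<sigma> * (x - ?s)) has_real_derivative \<sigma>) (at ?s)"
      by (auto intro!: derivative_eq_intros)
    moreover have "((f \<circ> \<gamma>) has_real_derivative g') (at (t + \<sigma> * (?s - ?s)))" using g' by simp
    ultimately have D: "((\<lambda>x. (f \<circ> \<gamma>) (t + \<sigma> * (x - ?s))) has_real_derivative g' * \<sigma>) (at ?s)"
      by (rule DERIV_chain2[rotated])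
    have ev: "\<forall>\<^sub>F x in nhds ?s. (f \<circ> c e) x = (f \<circ> \<gamma>) (t + \<sigma> * (x - ?s))"
      unfolding eventually_nhds_metric
    proof (intro exI[of _ \<eta>] conjI allI impI)
      fix x assume "dist x ?s < \<eta>"
      then have "\<bar>(t + \<sigma> * (x - ?s)) - t\<bar> < \<eta>" using *(2) by (simp add: dist_real_def abs_mult)
      from *(3)[OF this] have r: "t + \<sigma> * (x - ?s) \<in> edge_times (L, \<gamma>) e"
        "chart_coord e (\<gamma> (t + \<sigma> * (x - ?s))) = x"
        using \<sigma> by (auto simp: mult.assoc[symmetric])
      show "(f \<circ> c e) x = (f \<circ> \<gamma>) (t + \<sigma> * (x - ?s))"
        using edge_times_chart_coord(2)[OF assms(2) r(1)] r(2) by simp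
    qed (rule *(1))
    show ?thesis
      using D by (subst mult.commute) (rule DERIV_cong_ev[OF refl ev refl, THEN iffD2])
  qed
  from 1 2 *(2) show ?thesis by blast
qed

section \<open>Common pieces of the segments and the edges\<close>

lemma segment_props:
  assumes "segment M d (L, \<gamma>)"
  shows "0 < L" "\<And>t. t \<in> {0..L} \<Longrightarrow> \<gamma> t \<in> M" "inj_on \<gamma> {0..L}"
  using assms by (auto simp: segment_def)

lemma subdivision_props:
  assumes "subdivision M d S"
  shows "finite S" "\<And>L \<gamma>. (L, \<gamma>) \<in> S \<Longrightarrow> segment M d (L, \<gamma>)"
    and "(\<Union>(L, \<gamma>)\<in>S. \<gamma> ` {0..L}) = M"
    and "\<And>L \<gamma> L' \<gamma>' t t'. (L, \<gamma>) \<in> S \<Longrightarrow> (L', \<gamma>') \<in> S \<Longrightarrow> (L, \<gamma>) \<noteq> (L', \<gamma>')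
      \<Longrightarrow> t \<in> {0<..<L} \<Longrightarrow> t' \<in> {0..L'} \<Longrightarrow> \<gamma> t \<noteq> \<gamma>' t'"
proof -
  show "finite S" "\<And>L \<gamma>. (L, \<gamma>) \<in> S \<Longrightarrow> segment M d (L, \<gamma>)"
    "(\<Union>(L, \<gamma>)\<in>S. \<gamma> ` {0..L}) = M"
    using assms unfolding subdivision_def by blast+
  fix L \<gamma> L' \<gamma>' t t'
  assume *: "(L, \<gamma>) \<in> S" "(L', \<gamma>') \<in> S" "(L, \<gamma>) \<noteq> (L', \<gamma>')" "t \<in> {0<..<L}" "t' \<in> {0..L'}"
  have "\<forall>(L, \<gamma>)\<in>S. \<forall>(L', \<gamma>')\<in>S. (L, \<gamma>) \<noteq> (L', \<gamma>') \<longrightarrow> \<gamma> ` {0<..<L} \<inter> \<gamma>' ` {0..L'} = {}"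
    using assms by (simp add: subdivision_def)
  from bspec[OF this *(1)]
  have "\<forall>(L', \<gamma>')\<in>S. (L, \<gamma>) \<noteq> (L', \<gamma>') \<longrightarrow> \<gamma> ` {0<..<L} \<inter> \<gamma>' ` {0..L'} = {}"
    by (simp only: case_prod_conv)
  from bspec[OF this *(2)] *(3) have "\<gamma> ` {0<..<L} \<inter> \<gamma>' ` {0..L'} = {}" by simp
  with *(4,5) show "\<gamma> t \<noteq> \<gamma>' t'" by blast
qed

text \<open>The missing parameters are the ends of the segment and those sent to ends of edges;
  there are finitely many because a segment is injective.\<close>

lemma edge_times_cover:
  assumes "segment M d (L, \<gamma>)"
  shows "finite ({0..L} - (\<Union>e\<in>E. edge_times (L, \<gamma>) e))"
proof -
  let ?P = "(\<lambda>e. c e 0) ` E \<union> (\<lambda>e. c e (len e)) ` E"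
  have "{0..L} - (\<Union>e\<in>E. edge_times (L, \<gamma>) e) \<subseteq> {0, L} \<union> (\<gamma> -` ?P \<inter> {0..L})"
  proof
    fix t assume t: "t \<in> {0..L} - (\<Union>e\<in>E. edge_times (L, \<gamma>) e)"
    then obtain e s where es: "e \<in> E" "s \<in> {0..len e}" "\<gamma> t = c e s"
      using segment_props(2)[OF assms, of t] unfolding carrier_eq by auto
    show "t \<in> {0, L} \<union> (\<gamma> -` ?P \<inter> {0..L})"
    proof (cases "s = 0 \<or> s = len e")
      case True
      then show ?thesis using es t by auto
    next
      case False
      then have "s \<in> {0<..<len e}" using es by auto
      then have "t \<notin> {0<..<L}" using t es by (auto simp: edge_times_def)
      then show ?thesis using t by auto
    qed
  qed
  moreover have "finite (\<gamma> -` ?P \<inter> {0..L})"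
    using finite_edges segment_props(3)[OF assms] by (intro finite_vimage_IntI) auto
  ultimately show ?thesis by (meson finite.emptyI finite.insertI finite_UnI finite_subset)
qed

lemma edge_times_disjoint:
  assumes "e \<in> E" "e' \<in> E" "e \<noteq> e'"
  shows "edge_times (L, \<gamma>) e \<inter> edge_times (L, \<gamma>) e' = {}"
proof -
  have False if "t \<in> edge_times (L, \<gamma>) e" "t \<in> edge_times (L, \<gamma>) e'" for t
    using chart_eq[OF assms(1,2) edge_times_chart_coord(1)[OF assms(1) that(1)], of "chart_coord e' (\<gamma> t)"]
      edge_times_chart_coord[OF assms(1) that(1)] edge_times_chart_coord[OF assms(2) that(2)] assms(3)
    by auto
  then show ?thesis by blast
qed

definition traversed :: "real \<times> (real \<Rightarrow> 'a) \<Rightarrow> 'e \<Rightarrow> real set"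
  where "traversed s e = (\<lambda>t. chart_coord e (snd s t)) ` edge_times s e"

lemma traversed_subset: "e \<in> E \<Longrightarrow> traversed s e \<subseteq> {0<..<len e}"
  using edge_times_chart_coord(1)[of e _ "fst s" "snd s"] by (auto simp: traversed_def)

lemma traversed_disjoint:
  assumes S: "subdivision M d S" "s \<in> S" "s' \<in> S" "s \<noteq> s'" and e: "e \<in> E"
  shows "traversed s e \<inter> traversed s' e = {}"
proof -
  obtain L \<gamma> L' \<gamma>' where s: "s = (L, \<gamma>)" "s' = (L', \<gamma>')" by (cases s, cases s')
  have False if t: "t \<in> edge_times (L, \<gamma>) e" "t' \<in> edge_times (L', \<gamma>') e"
    "chart_coord e (\<gamma> t) = chart_coord e (\<gamma>' t')" for t t'
  proof -
    have "\<gamma> t = \<gamma>' t'" using edge_times_chart_coord(2)[OF e] t by metis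
    moreover have "t \<in> {0<..<L}" "t' \<in> {0..L'}" using t by (auto simp: edge_times_def)
    ultimately show False using subdivision_props(4)[OF S(1)] S(2-4) s by blast
  qed
  then show ?thesis by (auto simp: traversed_def s)
qed

text \<open>Dually, only the ends of the edge and the coordinates of ends of segments are missed;
  injectivity of the chart on the open edge makes them finite in number.\<close>

lemma traversed_cover:
  assumes S: "subdivision M d S" and e: "e \<in> E"
  shows "finite ({0..len e} - (\<Union>s\<in>S. traversed s e))"
proof -
  let ?P = "(\<lambda>s. snd s 0) ` S \<union> (\<lambda>s. snd s (fst s)) ` S"
  have "{0..len e} - (\<Union>s\<in>S. traversed s e) \<subseteq> {0, len e} \<union> (c e -` ?P \<inter> {0<..<len e})"
  proof
    fix x assume x: "x \<in> {0..len e} - (\<Union>s\<in>S. traversed s e)"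
    show "x \<in> {0, len e} \<union> (c e -` ?P \<inter> {0<..<len e})"
    proof (cases "x = 0 \<or> x = len e")
      case False
      then have xi: "x \<in> {0<..<len e}" using x by auto
      have "c e x \<in> (\<Union>(L, \<gamma>)\<in>S. \<gamma> ` {0..L})"
        using chart_in_carrier[OF e, of x] x subdivision_props(3)[OF S] by auto
      then obtain L \<gamma> t where t: "(L, \<gamma>) \<in> S" "t \<in> {0..L}" "c e x = \<gamma> t" by auto
      have "t \<notin> {0<..<L}"
      proof
        assume "t \<in> {0<..<L}"
        moreover have "\<gamma> t \<in> c e ` {0<..<len e}" using xi t(3)[symmetric] by (rule rev_image_eqI)
        ultimately have tt: "t \<in> edge_times (L, \<gamma>) e" by (simp add: edge_times_def)
        have "x = chart_coord e (snd (L, \<gamma>) t)" using chart_coord[OF e xi] t(3) by simp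
        then have "x \<in> traversed (L, \<gamma>) e" unfolding traversed_def using tt by (rule image_eqI)
        with x t(1) show False by blast
      qed
      then have "t = 0 \<or> t = L" using t(2) by auto
      then have "c e x \<in> ?P" using t(1,3) by force
      then show ?thesis using xi by blast
    qed auto
  qed
  moreover have "finite (c e -` ?P \<inter> {0<..<len e})"
    using subdivision_props(1)[OF S] chart_inj[OF e] by (intro finite_vimage_IntI) auto
  ultimately show ?thesis by (meson finite.emptyI finite.insertI finite_UnI finite_subset)
qed

text \<open>Change of variables along the edge coordinate, which is injective with derivative of
  absolute value 1. The integrand is continuous on the segment, and integrability is transported
  from there to the edge.\<close>

lemma has_integral_edge_times:
  fixes G \<Phi> :: "real \<Rightarrow> real"
  assumes seg: "segment M d (L, \<gamma>)" and e: "e \<in> E"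
    and G: "continuous_on {0..L} G"
    and eq: "\<And>t. t \<in> edge_times (L, \<gamma>) e \<Longrightarrow> G t = \<Phi> (chart_coord e (\<gamma> t))"
  shows "(G has_integral integral (edge_times (L, \<gamma>) e) G) (edge_times (L, \<gamma>) e)"
    and "(\<Phi> has_integral integral (edge_times (L, \<gamma>) e) G) (traversed (L, \<gamma>) e)"
proof -
  let ?T = "edge_times (L, \<gamma>) e" and ?\<tau> = "\<lambda>t. chart_coord e (\<gamma> t)"
  have T: "?T \<in> sets lebesgue" using open_edge_times[OF seg e] by auto
  have "G absolutely_integrable_on {0..L}"
    using absolutely_integrable_continuous_real G by blast
  then have GT: "G absolutely_integrable_on ?T"
    by (rule set_integrable_subset) (use T in \<open>auto simp: edge_times_def\<close>)
  then show "(G has_integral integral ?T G) ?T"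
    by (simp add: set_lebesgue_integral_eq_integral(1) integrable_integral)
  obtain \<sigma> where \<sigma>: "\<And>t. t \<in> ?T \<Longrightarrow> \<bar>\<sigma> t\<bar> = 1"
    "\<And>t. t \<in> ?T \<Longrightarrow> (?\<tau> has_real_derivative \<sigma> t) (at t)"
    using chart_coord_derivative[OF seg e] by metis
  have G_eq: "\<bar>\<sigma> t\<bar> * \<Phi> (?\<tau> t) = G t" if "t \<in> ?T" for t
    using \<sigma>(1)[OF that] eq[OF that] by simp
  have "(\<lambda>t. \<bar>\<sigma> t\<bar> * \<Phi> (?\<tau> t)) absolutely_integrable_on ?T \<and>
      integral ?T (\<lambda>t. \<bar>\<sigma> t\<bar> * \<Phi> (?\<tau> t)) = integral ?T G"
  proof
    show "(\<lambda>t. \<bar>\<sigma> t\<bar> * \<Phi> (?\<tau> t)) absolutely_integrable_on ?T"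
      using GT by (rule absolutely_integrable_spike[OF _ negligible_empty]) (simp add: G_eq)
    show "integral ?T (\<lambda>t. \<bar>\<sigma> t\<bar> * \<Phi> (?\<tau> t)) = integral ?T G"
      by (rule integral_cong) (rule G_eq)
  qed
  then have "\<Phi> absolutely_integrable_on (?\<tau> ` ?T) \<and> integral (?\<tau> ` ?T) \<Phi> = integral ?T G"
    using has_absolute_integral_change_of_variables_1'[OF T _ chart_coord_inj[OF seg e], of \<sigma> \<Phi>]
      \<sigma>(2) has_field_derivative_at_within by blast
  then show "(\<Phi> has_integral integral ?T G) (traversed (L, \<gamma>) e)"
    unfolding traversed_def snd_conv
    by (metis integrable_integral set_lebesgue_integral_eq_integral(1))
qed

text \<open>Double summation over pairs of a segment and an edge: up to finite sets, the pieces
  partition each segment by edges and each edge by segments, and the integral over a piece is the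
  same on both sides.\<close>

lemma integral_subdivision:
  fixes G :: "real \<times> (real \<Rightarrow> 'a) \<Rightarrow> real \<Rightarrow> real" and \<Phi> :: "'e \<Rightarrow> real \<Rightarrow> real"
  assumes S: "subdivision M d S"
    and cont: "\<And>L \<gamma>. (L, \<gamma>) \<in> S \<Longrightarrow> continuous_on {0..L} (G (L, \<gamma>))"
    and eq: "\<And>L \<gamma> e t. (L, \<gamma>) \<in> S \<Longrightarrow> e \<in> E \<Longrightarrow> t \<in> edge_times (L, \<gamma>) e
      \<Longrightarrow> G (L, \<gamma>) t = \<Phi> e (chart_coord e (\<gamma> t))"
  shows "\<And>e. e \<in> E \<Longrightarrow> \<Phi> e integrable_on {0..len e}"
    and "(\<Sum>(L, \<gamma>)\<in>S. integral {0..L} (G (L, \<gamma>))) = (\<Sum>e\<in>E. integral {0..len e} (\<Phi> e))"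
proof -
  note finS = subdivision_props(1)[OF S]
  note seg = subdivision_props(2)[OF S]
  define I where "I s e = integral (edge_times s e) (G s)" for s e
  have B: "(G (L, \<gamma>) has_integral (\<Sum>e\<in>E. I (L, \<gamma>) e)) {0..L}" if s: "(L, \<gamma>) \<in> S" for L \<gamma>
  proof -
    have "(G (L, \<gamma>) has_integral (\<Sum>e\<in>E. I (L, \<gamma>) e)) (\<Union>e\<in>E. edge_times (L, \<gamma>) e)"
    proof (rule has_integral_UN[OF finite_edges])
      show "(G (L, \<gamma>) has_integral I (L, \<gamma>) e) (edge_times (L, \<gamma>) e)" if "e \<in> E" for e
        unfolding I_def using has_integral_edge_times(1)[OF seg[OF s] that cont[OF s] eq[OF s that]] .
    qed (auto simp: pairwise_def edge_times_disjoint)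
    then show ?thesis
    proof (rule has_integral_spike_set_eq[THEN iffD1, rotated 2])
      have "(\<Union>e\<in>E. edge_times (L, \<gamma>) e) \<subseteq> {0..L}" by (auto simp: edge_times_def)
      then show "negligible {x \<in> (\<Union>e\<in>E. edge_times (L, \<gamma>) e) - {0..L}. G (L, \<gamma>) x \<noteq> 0}"
        by (intro negligible_subset[OF negligible_empty]) blast
      show "negligible {x \<in> {0..L} - (\<Union>e\<in>E. edge_times (L, \<gamma>) e). G (L, \<gamma>) x \<noteq> 0}"
        by (rule negligible_subset[OF negligible_finite[OF edge_times_cover[OF seg[OF s]]]]) blast
    qed
  qed
  have C: "(\<Phi> e has_integral (\<Sum>s\<in>S. I s e)) {0..len e}" if e: "e \<in> E" for e
  proof -
    have "(\<Phi> e has_integral (\<Sum>s\<in>S. I s e)) (\<Union>s\<in>S. traversed s e)"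
    proof (rule has_integral_UN[OF finS])
      fix s assume s: "s \<in> S"
      obtain L \<gamma> where [simp]: "s = (L, \<gamma>)" by (cases s)
      have s: "(L, \<gamma>) \<in> S" using s by simp
      show "(\<Phi> e has_integral I s e) (traversed s e)"
        using has_integral_edge_times(2)[OF seg[OF s] e cont[OF s] eq[OF s e]]
        by (simp add: I_def)
    qed (auto simp: pairwise_def traversed_disjoint[OF S _ _ _ e])
    then show ?thesis
    proof (rule has_integral_spike_set_eq[THEN iffD1, rotated 2])
      have "(\<Union>s\<in>S. traversed s e) \<subseteq> {0..len e}"
        using traversed_subset[OF e] by fastforce
      then show "negligible {x \<in> (\<Union>s\<in>S. traversed s e) - {0..len e}. \<Phi> e x \<noteq> 0}"
        by (intro negligible_subset[OF negligible_empty]) blast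
      show "negligible {x \<in> {0..len e} - (\<Union>s\<in>S. traversed s e). \<Phi> e x \<noteq> 0}"
        by (rule negligible_subset[OF negligible_finite[OF traversed_cover[OF S e]]]) blast
    qed
  qed
  show "\<Phi> e integrable_on {0..len e}" if "e \<in> E" for e
    using C[OF that] by blast
  have "(\<Sum>(L, \<gamma>)\<in>S. integral {0..L} (G (L, \<gamma>))) = (\<Sum>s\<in>S. \<Sum>e\<in>E. I s e)"
    using B by (intro sum.cong refl) (auto simp: integral_unique)
  also have "\<dots> = (\<Sum>e\<in>E. \<Sum>s\<in>S. I s e)" by (rule sum.swap)
  also have "\<dots> = (\<Sum>e\<in>E. integral {0..len e} (\<Phi> e))"
    by (intro sum.cong refl integral_unique[symmetric] C)
  finally show "(\<Sum>(L, \<gamma>)\<in>S. integral {0..L} (G (L, \<gamma>))) = (\<Sum>e\<in>E. integral {0..len e} (\<Phi> e))" .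
qed

section \<open>Piecewise smooth functions restricted to the edges\<close>

lemma C2_on_segment_derivative:
  assumes "C2_on_segment L g" and "t \<in> {0<..<L}"
  shows "(g has_real_derivative seg_deriv L g t) (at t)"
proof -
  have "g differentiable at t within {0..L}"
    using assms by (auto simp: C2_on_segment_def differentiable_on_def)
  then have "(g has_vector_derivative seg_deriv L g t) (at t within {0..L})"
    unfolding seg_deriv_def by (simp add: vector_derivative_works)
  then show ?thesis
    using assms(2) at_within_Icc_at[of 0 t L] by (simp add: has_real_derivative_iff_has_vector_derivative)
qed

text \<open>Smoothness speaks of each segment separately. Continuity across junctions comes from the
  finite compact cover of \<open>M\<close>, and then passes to the charts because these are
  non-expanding.\<close>

lemma smooth_along_continuous:
  assumes S: "subdivision M d S" and f: "smooth_along S f" and e: "e \<in> E"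
  shows "continuous_on {0..len e} (f \<circ> c e)"
proof (rule continuous_along_chart[OF _ e])
  fix x \<epsilon> assume "x \<in> M" "0 < (\<epsilon> :: real)"
  moreover have "continuous_on {0..L} (f \<circ> \<gamma>)" if "(L, \<gamma>) \<in> S" for L \<gamma>
    using f that unfolding smooth_along_def C2_on_segment_def
    by (blast intro: differentiable_imp_continuous_on)
  ultimately show "\<exists>\<delta>>0. \<forall>y\<in>M. d x y < \<delta> \<longrightarrow> \<bar>f y - f x\<bar> < \<epsilon>"
    using subdivision_props(3)[OF S]
    by (intro continuous_of_segments[OF subdivision_props(1,2)[OF S]]) auto
qed

text \<open>This removes the subdivision from the argument: what remains is one function on each
  edge, differentiable off a finite set, with mass and energy as edge integrals.\<close>

lemma edge_integrals:
  fixes f :: "'a \<Rightarrow> real"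
  assumes S: "subdivision M d S" and f: "smooth_along S f"
  shows "\<exists>(K :: 'e \<Rightarrow> real set) D. (\<forall>e\<in>E. finite (K e) \<and>
      (\<forall>x\<in>{0<..<len e} - K e. ((f \<circ> c e) has_real_derivative D e x) (at x)) \<and>
      (\<lambda>x. (D e x)\<^sup>2) integrable_on {0..len e}) \<and>
    mass_along S f = (\<Sum>e\<in>E. integral {0..len e} (\<lambda>x. ((f \<circ> c e) x)\<^sup>2)) \<and>
    energy_along S f = (\<Sum>e\<in>E. integral {0..len e} (\<lambda>x. (D e x)\<^sup>2))"
proof -
  note seg = subdivision_props(2)[OF S]
  have C2: "C2_on_segment L (f \<circ> \<gamma>)" if "(L, \<gamma>) \<in> S" for L \<gamma>
    using f that by (auto simp: smooth_along_def)
  then have cont: "continuous_on {0..L} (f \<circ> \<gamma>)" "continuous_on {0..L} (seg_deriv L (f \<circ> \<gamma>))"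
    if "(L, \<gamma>) \<in> S" for L \<gamma>
    using that unfolding C2_on_segment_def by (blast intro: differentiable_imp_continuous_on)+
  have deriv: "((f \<circ> \<gamma>) has_real_derivative seg_deriv L (f \<circ> \<gamma>) t) (at t)"
    if "(L, \<gamma>) \<in> S" "t \<in> edge_times (L, \<gamma>) e" for L \<gamma> t e
    using C2_on_segment_derivative[OF C2[OF that(1)]] that(2) by (simp add: edge_times_def)
  have D: "\<exists>\<sigma>. \<bar>\<sigma>\<bar> = 1 \<and>
      ((f \<circ> c e) has_real_derivative \<sigma> * seg_deriv L (f \<circ> \<gamma>) t) (at (chart_coord e (\<gamma> t)))"
    if "(L, \<gamma>) \<in> S" "e \<in> E" "t \<in> edge_times (L, \<gamma>) e" for L \<gamma> e t
    using chart_coord_derivative[OF seg[OF that(1)] that(2,3)] deriv[OF that(1,3)] by blast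
  define K where "K e = {0..len e} - (\<Union>s\<in>S. traversed s e)" for e
  have finK: "finite (K e)" if "e \<in> E" for e
    unfolding K_def using traversed_cover[OF S that] .
  have deriv_chart: "((f \<circ> c e) has_real_derivative deriv (f \<circ> c e) x) (at x)"
    if e: "e \<in> E" and x: "x \<in> {0<..<len e} - K e" for e x
  proof -
    obtain s where s: "s \<in> S" "x \<in> traversed s e" using x by (auto simp: K_def)
    obtain L \<gamma> where L: "s = (L, \<gamma>)" by (cases s)
    with s obtain t where t: "t \<in> edge_times (L, \<gamma>) e" "x = chart_coord e (\<gamma> t)"
      by (auto simp: traversed_def)
    then show ?thesis using D[of L \<gamma> e t] s(1) e by (auto simp: L DERIV_deriv_iff_real_differentiable
        real_differentiable_def)
  qed
  have mass: "mass_along S f = (\<Sum>e\<in>E. integral {0..len e} (\<lambda>x. ((f \<circ> c e) x)\<^sup>2))"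
  proof -
    have "(\<Sum>(L, \<gamma>)\<in>S. integral {0..L} ((\<lambda>(L, \<gamma>) t. (f (\<gamma> t))\<^sup>2) (L, \<gamma>)))
        = (\<Sum>e\<in>E. integral {0..len e} (\<lambda>x. ((f \<circ> c e) x)\<^sup>2))"
    proof (rule integral_subdivision(2)[OF S])
      fix L \<gamma> assume "(L, \<gamma>) \<in> S"
      then show "continuous_on {0..L} ((\<lambda>(L, \<gamma>) t. (f (\<gamma> t))\<^sup>2) (L, \<gamma>))"
        using continuous_on_power[OF cont(1), of L \<gamma> 2] by (simp add: comp_def)
    qed (simp add: edge_times_chart_coord)
    then show ?thesis by (simp add: mass_along_def)
  qed
  define G where "G = (\<lambda>(L, \<gamma>) t. (seg_deriv L (f \<circ> \<gamma>) t)\<^sup>2)"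
  define \<Phi> where "\<Phi> = (\<lambda>e x. (deriv (f \<circ> c e) x)\<^sup>2)"
  have e2: "continuous_on {0..L} (G (L, \<gamma>))" if "(L, \<gamma>) \<in> S" for L \<gamma>
    using continuous_on_power[OF cont(2)[OF that], of 2] by (simp add: G_def)
  have e3: "G (L, \<gamma>) t = \<Phi> e (chart_coord e (\<gamma> t))"
    if t: "(L, \<gamma>) \<in> S" "e \<in> E" "t \<in> edge_times (L, \<gamma>) e" for L \<gamma> e t
  proof -
    obtain \<sigma> where \<sigma>: "\<bar>\<sigma>\<bar> = 1"
      "((f \<circ> c e) has_real_derivative \<sigma> * seg_deriv L (f \<circ> \<gamma>) t) (at (chart_coord e (\<gamma> t)))"
      using D[OF t] by blast
    \<comment> \<open>Squaring removes the sign that compares the directions of segment and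
      edge.\<close>
    have "\<sigma>\<^sup>2 = 1" using \<sigma>(1) by (metis power2_abs one_power2)
    then show ?thesis using DERIV_imp_deriv[OF \<sigma>(2)] by (simp add: G_def \<Phi>_def power_mult_distrib)
  qed
  have energy: "energy_along S f = (\<Sum>e\<in>E. integral {0..len e} (\<lambda>x. (deriv (f \<circ> c e) x)\<^sup>2))"
  proof -
    have "(\<Sum>(L, \<gamma>)\<in>S. integral {0..L} (G (L, \<gamma>))) = (\<Sum>e\<in>E. integral {0..len e} (\<Phi> e))"
      by (rule integral_subdivision(2)[OF S, of G \<Phi>]) (fact e2 e3)+
    then show ?thesis by (simp add: energy_along_def G_def \<Phi>_def)
  qed
  have "\<Phi> e integrable_on {0..len e}" if "e \<in> E" for e
    by (rule integral_subdivision(1)[OF S, of G \<Phi>]) (fact e2 e3 that)+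
  then have "(\<lambda>x. (deriv (f \<circ> c e) x)\<^sup>2) integrable_on {0..len e}" if "e \<in> E" for e
    using that by (simp add: \<Phi>_def)
  then show ?thesis
    using finK deriv_chart mass energy by (intro exI[of _ K] exI[of _ "\<lambda>e. deriv (f \<circ> c e)"]) blast
qed

end

section \<open>The cover by metric stars\<close>

context length_graph
begin

section \<open>Incidence sums and the normalized Laplacian as a matrix\<close>

definition incident :: "'v \<Rightarrow> 'v set set"
  where "incident v = {e \<in> E. v \<in> e}"

lemma finite_incident: "finite (incident v)"
  using finite_E by (simp add: incident_def)

lemma sum_incident:
  "(\<Sum>v\<in>V. \<Sum>e\<in>incident v. h v e) = (\<Sum>e\<in>E. \<Sum>v\<in>e. (h v e :: real))"
proof -
  have "(\<Sum>v\<in>V. \<Sum>e\<in>incident v. h v e) = (\<Sum>e\<in>E. \<Sum>v | v \<in> V \<and> v \<in> e. h v e)"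
    unfolding incident_def by (rule sum.swap_restrict[OF finite_V finite_E])
  also have "\<dots> = (\<Sum>e\<in>E. \<Sum>v\<in>e. h v e)"
    using edge_subset by (intro sum.cong refl) blast
  finally show ?thesis .
qed

lemma not_loop: "{v, v} \<notin> E"
  using card_edge[of "{v, v}"] by auto

lemma sum_neighbours: "(\<Sum>u | {u, v} \<in> E. h {u, v}) = (\<Sum>e\<in>incident v. (h e :: real))"
proof -
  have inj: "inj_on (\<lambda>u. {u, v}) {u. {u, v} \<in> E}"
    by (auto simp: inj_on_def doubleton_eq_iff)
  have "incident v = (\<lambda>u. {u, v}) ` {u. {u, v} \<in> E}"
  proof
    show "incident v \<subseteq> (\<lambda>u. {u, v}) ` {u. {u, v} \<in> E}"
    proof
      fix e assume e: "e \<in> incident v"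
      then obtain a b where "e = {a, b}" using edge_ends by (metis incident_def mem_Collect_eq)
      then have "e = {a, v} \<or> e = {b, v}" using e by (auto simp: incident_def)
      then show "e \<in> (\<lambda>u. {u, v}) ` {u. {u, v} \<in> E}" using e by (auto simp: incident_def)
    qed
  qed (auto simp: incident_def)
  then show ?thesis by (simp add: sum.reindex[OF inj])
qed

lemma weighted_degree_eq: "weighted_degree E l v = (\<Sum>e\<in>incident v. l e)"
  unfolding weighted_degree_def by (rule sum_neighbours)

lemma weighted_degree_pos:
  assumes "card V \<ge> 2" and "v \<in> V"
  shows "0 < weighted_degree E l v"
  unfolding weighted_degree_eq using vertex_in_edge[OF assms] length_pos
  by (intro sum_pos finite_incident) (auto simp: incident_def)

text \<open>Writing \<open>x v - x u\<close> as \<open>2 * x v - (x u + x v)\<close> expresses the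
  term through the edge and its centre \<open>v\<close>, without naming the neighbour.\<close>

lemma weighted_laplacian_eq:
  "weighted_laplacian E l x v = (\<Sum>e\<in>incident v. l e * (2 * x v - (\<Sum>w\<in>e. x w)))"
proof -
  have "weighted_laplacian E l x v = (\<Sum>u | {u, v} \<in> E. l {u, v} * (2 * x v - (\<Sum>w\<in>{u, v}. x w)))"
    unfolding weighted_laplacian_def
  proof (intro sum.cong refl)
    fix u assume "u \<in> {u. {u, v} \<in> E}"
    then have "u \<noteq> v" using not_loop by auto
    then show "l {u, v} * (x v - x u) = l {u, v} * (2 * x v - (\<Sum>w\<in>{u, v}. x w))" by simp
  qed
  then show ?thesis
    using sum_neighbours[of "\<lambda>e. l e * (2 * x v - (\<Sum>w\<in>e. x w))" v] by simp
qed

text \<open>The matrix \<open>D\<^sup>-\<^sup>1\<^sup>/\<^sup>2 (D - W)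
  D\<^sup>-\<^sup>1\<^sup>/\<^sup>2\<close>, with \<open>D\<close> the diagonal of weighted degrees
  and \<open>W\<close> the weighted adjacency matrix.\<close>

definition nr_kernel :: "'v \<Rightarrow> 'v \<Rightarrow> real"
  where "nr_kernel v u = ((if u = v then weighted_degree E l v else 0) - (if {u, v} \<in> E then l {u, v} else 0))
    / (sqrt (weighted_degree E l v) * sqrt (weighted_degree E l u))"

lemma weighted_laplacian_kernel:
  assumes "v \<in> V"
  shows "weighted_laplacian E l x v
    = (\<Sum>u\<in>V. ((if u = v then weighted_degree E l v else 0) - (if {u, v} \<in> E then l {u, v} else 0)) * x u)"
proof -
  have V: "{u \<in> V. {u, v} \<in> E} = {u. {u, v} \<in> E}" using edge_subset by blast
  have "(\<Sum>u\<in>V. (if {u, v} \<in> E then l {u, v} else 0) * x u) = (\<Sum>u\<in>V. if {u, v} \<in> E then l {u, v} * x u else 0)"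
    by (intro sum.cong) auto
  also have "\<dots> = (\<Sum>u | {u, v} \<in> E. l {u, v} * x u)"
    using sum.inter_filter[OF finite_V, of "\<lambda>u. l {u, v} * x u" "\<lambda>u. {u, v} \<in> E"] by (simp add: V)
  moreover have "(\<Sum>u\<in>V. (if u = v then weighted_degree E l v else 0) * x u) = weighted_degree E l v * x v"
    using finite_V assms by (simp add: mult_delta_left)
  ultimately show ?thesis
    by (simp add: weighted_laplacian_def weighted_degree_def left_diff_distrib right_diff_distrib
        sum_subtractf sum_distrib_right)
qed

lemma symmetric_operator_normalized_laplacian:
  "symmetric_operator V nr_kernel (normalized_laplacian E l)"
proof
  show "nr_kernel u v = nr_kernel v u" for u v
    by (simp add: nr_kernel_def insert_commute mult.commute)
  show "normalized_laplacian E l f v = (\<Sum>u\<in>V. nr_kernel v u * f u)" if "v \<in> V" for f v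
    using that unfolding normalized_laplacian_def inv_sqrt_degree_def[of E l "weighted_laplacian E l _"]
    by (simp add: weighted_laplacian_kernel nr_kernel_def inv_sqrt_degree_def sum_divide_distrib mult_ac)
qed (rule finite_V)

text \<open>The quadratic form of the weighted signless Laplacian, degrees plus adjacency.\<close>

definition edge_form :: "('v \<Rightarrow> real) \<Rightarrow> real"
  where "edge_form x = (\<Sum>e\<in>E. l e * (\<Sum>v\<in>e. x v)\<^sup>2)"

lemma edge_form_nonneg: "0 \<le> edge_form x"
  unfolding edge_form_def using length_pos by (auto intro!: sum_nonneg simp: less_imp_le)

text \<open>Degrees plus adjacency is twice the degrees minus the Laplacian; the rescaling by square
  roots of degrees turns this into 2 minus the normalized Laplacian.\<close>

lemma edge_form_eq:
  assumes V2: "card V \<ge> 2"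
  shows "edge_form (inv_sqrt_degree E l g)
    = 2 * inner_on V g g - inner_on V (normalized_laplacian E l g) g"
proof -
  let ?d = "weighted_degree E l"
  define x where "x = inv_sqrt_degree E l g"
  have pos: "0 < ?d v" if "v \<in> V" for v by (rule weighted_degree_pos[OF V2 that])
  have g: "g v = sqrt (?d v) * x v" if "v \<in> V" for v
    using pos[OF that] by (simp add: x_def inv_sqrt_degree_def)
  have 1: "inner_on V g g = (\<Sum>e\<in>E. \<Sum>v\<in>e. l e * (x v)\<^sup>2)"
  proof -
    have "inner_on V g g = (\<Sum>v\<in>V. \<Sum>e\<in>incident v. l e * (x v)\<^sup>2)"
      unfolding inner_on_def
    proof (intro sum.cong refl)
      fix v assume v: "v \<in> V"
      have "g v * g v = ?d v * (x v)\<^sup>2"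
        using pos[OF v] by (simp add: g[OF v] power2_eq_square algebra_simps)
      then show "g v * g v = (\<Sum>e\<in>incident v. l e * (x v)\<^sup>2)"
        by (simp add: weighted_degree_eq sum_distrib_right)
    qed
    then show ?thesis by (simp add: sum_incident)
  qed
  have 2: "inner_on V (normalized_laplacian E l g) g
      = (\<Sum>e\<in>E. \<Sum>v\<in>e. l e * (2 * (x v)\<^sup>2 - x v * (\<Sum>w\<in>e. x w)))"
  proof -
    have "inner_on V (normalized_laplacian E l g) g
        = (\<Sum>v\<in>V. \<Sum>e\<in>incident v. l e * (2 * (x v)\<^sup>2 - x v * (\<Sum>w\<in>e. x w)))"
      unfolding inner_on_def
    proof (intro sum.cong refl)
      fix v assume v: "v \<in> V"
      have "normalized_laplacian E l g v * g v = weighted_laplacian E l x v * x v"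
        using pos[OF v]
        by (simp add: normalized_laplacian_def inv_sqrt_degree_def[of E l "weighted_laplacian E l _"]
            x_def[symmetric] g[OF v])
      also have "\<dots> = (\<Sum>e\<in>incident v. l e * (2 * (x v)\<^sup>2 - x v * (\<Sum>w\<in>e. x w)))"
        unfolding weighted_laplacian_eq sum_distrib_right
        by (intro sum.cong refl) (simp add: power2_eq_square algebra_simps)
      finally show "normalized_laplacian E l g v * g v
          = (\<Sum>e\<in>incident v. l e * (2 * (x v)\<^sup>2 - x v * (\<Sum>w\<in>e. x w)))" .
    qed
    then show ?thesis by (simp add: sum_incident)
  qed
  have "2 * (\<Sum>v\<in>e. l e * (x v)\<^sup>2) - (\<Sum>v\<in>e. l e * (2 * (x v)\<^sup>2 - x v * (\<Sum>w\<in>e. x w)))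
      = l e * (\<Sum>v\<in>e. x v)\<^sup>2" for e
  proof -
    have "(\<Sum>v\<in>e. l e * (2 * (x v)\<^sup>2 - x v * (\<Sum>w\<in>e. x w)))
        = l e * (2 * (\<Sum>v\<in>e. (x v)\<^sup>2) - (\<Sum>v\<in>e. x v) * (\<Sum>w\<in>e. x w))"
      by (simp add: sum_distrib_left[symmetric] sum_subtractf sum_distrib_right[symmetric])
    then show ?thesis
      by (simp add: sum_distrib_left[symmetric] power2_eq_square algebra_simps)
  qed
  then have "(\<Sum>e\<in>E. l e * (\<Sum>v\<in>e. x v)\<^sup>2) = 2 * inner_on V g g - inner_on V (normalized_laplacian E l g) g"
    unfolding 1 2 by (simp only: sum_distrib_left sum_subtractf[symmetric])
  then show ?thesis by (simp add: edge_form_def x_def)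
qed

text \<open>The signless form is nonnegative. The bound keeps the factor \<open>2 - \<nu>\<close>
  nonnegative when all star means vanish.\<close>

lemma nr_eigenvalue_le_2:
  assumes "card V \<ge> 2" and "eigenspace_on V (normalized_laplacian E l) \<nu> \<noteq> {0}"
  shows "\<nu> \<le> 2"
proof -
  interpret N: symmetric_operator V nr_kernel "normalized_laplacian E l"
    by (rule symmetric_operator_normalized_laplacian)
  have "0 \<in> eigenspace_on V (normalized_laplacian E l) \<nu>"
    by (simp add: eigenspace_on_def N.operator_kernel)
  then obtain h where h: "h \<in> eigenspace_on V (normalized_laplacian E l) \<nu>" "h \<noteq> 0"
    using assms(2) by blast
  then have "inner_on V h h \<noteq> 0"
    using finite_V by (auto simp: inner_on_self_eq_0 eigenspace_on_def fun_eq_iff)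
  then have "0 < inner_on V h h" using inner_on_self_nonneg[of V h] by linarith
  moreover have "inner_on V (normalized_laplacian E l h) h = \<nu> * inner_on V h h"
    using h(1) by (simp add: inner_on_def eigenspace_on_def sum_distrib_left mult.assoc)
  then have "\<nu> * inner_on V h h \<le> 2 * inner_on V h h"
    using edge_form_nonneg[of "inv_sqrt_degree E l h"] edge_form_eq[OF assms(1), of h] by linarith
  ultimately show ?thesis by simp
qed

text \<open>\<open>a e\<close> and \<open>q e\<close> stand for the integrals of \<open>f\<close> and \<open>f\<^sup>2\<close> over the edge \<open>e\<close>. The components
  of \<open>star_mean a\<close> are the means of \<open>f\<close> over the metric stars, scaled by the square root of
  the length of the star.\<close>

definition star_mean :: "('v set \<Rightarrow> real) \<Rightarrow> 'v \<Rightarrow> real"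
  where "star_mean a v = (if v \<in> V then (\<Sum>e\<in>incident v. a e) / sqrt (weighted_degree E l v) else 0)"

lemma star_mean_bound:
  assumes V2: "card V \<ge> 2" and \<nu>2: "\<nu> \<le> 2"
    and aq: "\<And>e. e \<in> E \<Longrightarrow> (a e)\<^sup>2 \<le> l e * q e"
    and \<nu>: "\<nu> * inner_on V (star_mean a) (star_mean a)
      \<le> inner_on V (normalized_laplacian E l (star_mean a)) (star_mean a)"
  shows "inner_on V (star_mean a) (star_mean a) \<le> (2 - \<nu>) * (\<Sum>e\<in>E. q e)"
proof -
  define g where "g = star_mean a"
  define x where "x = inv_sqrt_degree E l g"
  define X where "X = inner_on V g g"
  have X: "X = (\<Sum>e\<in>E. a e * (\<Sum>v\<in>e. x v))"
  proof -
    have "X = (\<Sum>v\<in>V. \<Sum>e\<in>incident v. a e * x v)"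
      unfolding X_def inner_on_def
    proof (intro sum.cong refl)
      fix v assume v: "v \<in> V"
      have "g v * g v = (\<Sum>e\<in>incident v. a e) * x v"
        using v by (simp add: g_def star_mean_def x_def inv_sqrt_degree_def)
      then show "g v * g v = (\<Sum>e\<in>incident v. a e * x v)" by (simp add: sum_distrib_right)
    qed
    then show ?thesis by (simp add: sum_incident sum_distrib_left)
  qed
  have lpos: "0 < l e" if "e \<in> E" for e using length_pos that .
  have q_nonneg: "0 \<le> (\<Sum>e\<in>E. q e)"
  proof (rule sum_nonneg)
    fix e assume e: "e \<in> E"
    have "0 \<le> l e * q e" using aq[OF e] by (meson order_trans zero_le_power2)
    then show "0 \<le> q e" using lpos[OF e] by (simp add: zero_le_mult_iff)
  qed
  \<comment> \<open>The weights \<open>sqrt (l e)\<close> are split so that one Cauchy--Schwarz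
    factor is controlled by \<open>aq\<close> and the other is exactly
    \<open>edge_form x\<close>.\<close>
  have "X\<^sup>2 = (\<Sum>e\<in>E. (a e / sqrt (l e)) * (sqrt (l e) * (\<Sum>v\<in>e. x v)))\<^sup>2"
    unfolding X using lpos by (intro arg_cong[of _ _ "\<lambda>z. z\<^sup>2"] sum.cong) (auto simp: less_imp_neq[symmetric])
  also have "\<dots> \<le> (\<Sum>e\<in>E. (a e / sqrt (l e))\<^sup>2) * (\<Sum>e\<in>E. (sqrt (l e) * (\<Sum>v\<in>e. x v))\<^sup>2)"
    by (rule Cauchy_Schwarz_ineq_sum)
  also have "(\<Sum>e\<in>E. (sqrt (l e) * (\<Sum>v\<in>e. x v))\<^sup>2) = edge_form x"
    unfolding edge_form_def using lpos by (intro sum.cong) (auto simp: power_mult_distrib less_imp_le)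
  also have "(\<Sum>e\<in>E. (a e / sqrt (l e))\<^sup>2) * edge_form x \<le> (\<Sum>e\<in>E. q e) * ((2 - \<nu>) * X)"
  proof (rule mult_mono)
    show "(\<Sum>e\<in>E. (a e / sqrt (l e))\<^sup>2) \<le> (\<Sum>e\<in>E. q e)"
    proof (rule sum_mono)
      fix e assume "e \<in> E"
      then show "(a e / sqrt (l e))\<^sup>2 \<le> q e"
        using aq[of e] lpos[of e] by (simp add: power_divide field_simps)
    qed
    show "edge_form x \<le> (2 - \<nu>) * X"
      using \<nu> edge_form_eq[OF V2, of g] by (simp add: x_def X_def g_def algebra_simps)
  qed (rule q_nonneg edge_form_nonneg)+
  finally have main: "X * X \<le> ((2 - \<nu>) * (\<Sum>e\<in>E. q e)) * X" by (simp add: power2_eq_square mult_ac)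
  have "0 \<le> X" unfolding X_def by (rule inner_on_self_nonneg)
  show ?thesis
  proof (cases "X = 0")
    case True
    with q_nonneg \<nu>2 show ?thesis by (simp add: X_def g_def)
  next
    case False
    with \<open>0 \<le> X\<close> have "0 < X" by simp
    with main show ?thesis by (simp add: X_def g_def)
  qed
qed

text \<open>Summing the hypothesis \<open>energy\<close> over both ends of every edge counts the energy twice; the
  constants \<open>y v\<close> may be replaced by the means over the stars, which are the optimal constants.\<close>

lemma star_cover_energy:
  assumes V2: "card V \<ge> 2" and \<kappa>: "0 \<le> \<kappa>"
    and energy: "\<And>e v. e \<in> E \<Longrightarrow> v \<in> e \<Longrightarrow> \<kappa> * (q e - 2 * y v * a e + (y v)\<^sup>2 * l e) \<le> en e"
    and mean: "inner_on V (star_mean a) (star_mean a) \<le> (2 - \<nu>) * (\<Sum>e\<in>E. q e)"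
  shows "\<kappa> * \<nu> / 2 * (\<Sum>e\<in>E. q e) \<le> (\<Sum>e\<in>E. en e)"
proof -
  let ?d = "weighted_degree E l"
  define m where "m v = (\<Sum>e\<in>incident v. a e)" for v
  have "2 * (\<Sum>e\<in>E. q e) - inner_on V (star_mean a) (star_mean a)
      \<le> (\<Sum>v\<in>V. \<Sum>e\<in>incident v. q e - 2 * y v * a e + (y v)\<^sup>2 * l e)"
  proof -
    have "2 * (\<Sum>e\<in>E. q e) = (\<Sum>v\<in>V. \<Sum>e\<in>incident v. q e)"
      by (simp add: sum_incident sum_distrib_left card_edge)
    moreover have "(\<Sum>e\<in>incident v. q e) - star_mean a v * star_mean a v
        \<le> (\<Sum>e\<in>incident v. q e - 2 * y v * a e + (y v)\<^sup>2 * l e)" if v: "v \<in> V" for v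
    proof -
      have d: "0 < ?d v" by (rule weighted_degree_pos[OF V2 v])
      have "star_mean a v * star_mean a v = (m v)\<^sup>2 / ?d v"
        using v d by (simp add: star_mean_def m_def power2_eq_square)
      moreover have "(\<Sum>e\<in>incident v. q e - 2 * y v * a e + (y v)\<^sup>2 * l e)
          = (\<Sum>e\<in>incident v. q e) - 2 * y v * m v + (y v)\<^sup>2 * ?d v"
        by (simp add: sum.distrib sum_subtractf sum_distrib_left m_def weighted_degree_eq)
      \<comment> \<open>Completing the square in \<open>y v\<close>: the sum over the star is
        smallest at the mean \<open>m v / ?d v\<close>.\<close>
      moreover have "0 \<le> (y v * ?d v - m v)\<^sup>2 / ?d v" using d by simp
      moreover have "(y v * ?d v - m v)\<^sup>2 / ?d v = (y v)\<^sup>2 * ?d v - 2 * y v * m v + (m v)\<^sup>2 / ?d v"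
        using d by (simp add: power2_eq_square field_simps)
      ultimately show ?thesis by linarith
    qed
    then have "(\<Sum>v\<in>V. (\<Sum>e\<in>incident v. q e) - star_mean a v * star_mean a v)
        \<le> (\<Sum>v\<in>V. \<Sum>e\<in>incident v. q e - 2 * y v * a e + (y v)\<^sup>2 * l e)" by (rule sum_mono)
    ultimately show ?thesis by (simp add: inner_on_def sum_subtractf)
  qed
  then have "\<nu> * (\<Sum>e\<in>E. q e) \<le> (\<Sum>v\<in>V. \<Sum>e\<in>incident v. q e - 2 * y v * a e + (y v)\<^sup>2 * l e)"
    using mean by (simp add: algebra_simps)
  then have "\<kappa> * (\<nu> * (\<Sum>e\<in>E. q e)) \<le> \<kappa> * (\<Sum>v\<in>V. \<Sum>e\<in>incident v. q e - 2 * y v * a e + (y v)\<^sup>2 * l e)"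
    using \<kappa> by (rule mult_left_mono)
  also have "\<dots> = (\<Sum>e\<in>E. \<Sum>v\<in>e. \<kappa> * (q e - 2 * y v * a e + (y v)\<^sup>2 * l e))"
    unfolding sum_incident by (simp add: sum_distrib_left)
  also have "\<dots> \<le> (\<Sum>e\<in>E. \<Sum>v\<in>e. en e)" by (intro sum_mono energy)
  also have "\<dots> = 2 * (\<Sum>e\<in>E. en e)" by (simp add: card_edge sum_distrib_left)
  finally show ?thesis by simp
qed

end

section \<open>Rayleigh quotients on a metric graph\<close>

text \<open>\<open>a\<close> and \<open>b\<close> choose a direction on every edge, so that the
  undirected barycentric description acquires an arc length parameter.\<close>

locale modelled_metric_graph = Metric_space M d + length_graph V E l
  for M :: "'a set" and d :: "'a \<Rightarrow> 'a \<Rightarrow> real"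
    and V :: "'v set" and E :: "'v set set" and l :: "'v set \<Rightarrow> real" +
  fixes \<phi> :: "('v \<Rightarrow> real) \<Rightarrow> 'a" and a b :: "'v set \<Rightarrow> 'v"
  assumes image: "\<phi> ` realization V E = M"
    and isometric: "x \<in> realization V E \<Longrightarrow> y \<in> realization V E \<Longrightarrow> d (\<phi> x) (\<phi> y) = realization_dist E l x y"
    and ends: "e \<in> E \<Longrightarrow> e = {a e, b e}" "e \<in> E \<Longrightarrow> a e \<noteq> b e"
    and two_vertices: "card V \<ge> 2"
begin

definition chart :: "'v set \<Rightarrow> real \<Rightarrow> 'a"
  where "chart e t = \<phi> (edge_point (l e) (a e) (b e) t)"

lemma simplex_points_chart:
  assumes "e \<in> E"
  shows "simplex_points e = edge_point (l e) (a e) (b e) ` {0..l e}"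
  using simplex_points_edge[OF ends(2) length_pos] assms ends(1) by metis

lemma edge_point_in_realization:
  assumes "e \<in> E" and "t \<in> {0..l e}"
  shows "edge_point (l e) (a e) (b e) t \<in> simplex_points e"
    and "edge_point (l e) (a e) (b e) t \<in> realization V E"
proof -
  show *: "edge_point (l e) (a e) (b e) t \<in> simplex_points e"
    using assms by (simp add: simplex_points_chart)
  then show "edge_point (l e) (a e) (b e) t \<in> realization V E"
    using assms(1) unfolding realization_def by blast
qed

sublocale charted_graph M d E l chart
proof
  show "finite E" by (rule finite_E)
  show "0 < l e" if "e \<in> E" for e by (rule length_pos[OF that])
  show "M = (\<Union>e\<in>E. chart e ` {0..l e})"
    unfolding image[symmetric] realization_edges[OF two_vertices]
    by (auto simp: simplex_points_chart chart_def image_image)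
  fix e s t assume e: "e \<in> E"
  let ?p = "edge_point (l e) (a e) (b e)"
  have lab: "l {a e, b e} = l e" and ab: "{a e, b e} = e" using ends(1)[OF e] by auto
  show "d (chart e s) (chart e t) \<le> \<bar>s - t\<bar>" if "s \<in> {0..l e}" "t \<in> {0..l e}"
    using realization_dist_le[OF e, of "?p s" "?p t"] edge_point_in_realization[OF e] that
      edge_dist_edge_point[where l = l, of "a e" "b e" s t] ends(2)[OF e] length_pos[OF e]
    by (simp add: chart_def isometric ab)
  show "min \<bar>s - t\<bar> (min s (l e - s)) \<le> d (chart e s) (chart e t)" if "s \<in> {0<..<l e}" "t \<in> {0..l e}"
    using realization_dist_ge_same_edge[of "a e" "b e" s t] edge_point_in_realization[OF e] that
      ends(2)[OF e] e
    by (simp add: chart_def isometric ab)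
  fix e' assume e': "e' \<in> E" "e \<noteq> e'"
  show "min s (l e - s) \<le> d (chart e s) (chart e' t)" if "s \<in> {0<..<l e}" "t \<in> {0..l e'}"
    using realization_dist_ge_other_edge[of "a e" "b e" s e' "edge_point (l e') (a e') (b e') t"]
      edge_point_in_realization[OF e, of s] edge_point_in_realization[OF e'(1) that(2)] that
      ends(2)[OF e] e e'
    by (simp add: chart_def isometric ab)
qed

lemma chart_ends:
  assumes "e \<in> E"
  shows "chart e 0 = \<phi> (vertex_point (a e))" and "chart e (l e) = \<phi> (vertex_point (b e))"
  using assms by (simp_all add: chart_def edge_point_0 edge_point_L length_pos ends(2))

text \<open>The subdivision obtained is the very one picked by the choice operator in
  \<open>rayleigh\<close>, so the later estimates concern the quotient as defined.\<close>

lemma Zh_subdivision: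
  assumes "f \<in> Zh M d"
  obtains S where "subdivision M d S" "smooth_along S f"
    "rayleigh M d f = energy_along S f / mass_along S f"
proof -
  define S where "S = (SOME S. subdivision M d S \<and> smooth_along S f)"
  have "\<exists>S. subdivision M d S \<and> smooth_along S f" using assms by (auto simp: Zh_def)
  then have "subdivision M d S \<and> smooth_along S f" unfolding S_def by (rule someI_ex)
  then show ?thesis by (intro that) (simp_all add: rayleigh_def S_def[symmetric])
qed

lemma Zh_continuous_on_edge:
  assumes "f \<in> Zh M d" and "e \<in> E"
  shows "continuous_on {0..l e} (f \<circ> chart e)"
proof -
  obtain S where "subdivision M d S" "smooth_along S f" using Zh_subdivision[OF assms(1)] by metis
  then show ?thesis by (rule smooth_along_continuous[OF _ _ assms(2)])
qed

definition edge_mean :: "('a \<Rightarrow> real) \<Rightarrow> 'v \<Rightarrow> real"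
  where "edge_mean f = star_mean (\<lambda>e. integral {0..l e} (f \<circ> chart e))"

lemma rayleigh_ge:
  assumes f: "f \<in> Zh M d" "f \<noteq> 0" and \<nu>2: "\<nu> \<le> 2"
    and \<nu>: "\<nu> * inner_on V (edge_mean f) (edge_mean f)
      \<le> inner_on V (normalized_laplacian E l (edge_mean f)) (edge_mean f)"
  shows "pi\<^sup>2 / (8 * (max_length E l)\<^sup>2) * \<nu> \<le> rayleigh M d f"
proof -
  obtain S where S: "subdivision M d S" "smooth_along S f"
    "rayleigh M d f = energy_along S f / mass_along S f" using Zh_subdivision[OF f(1)] .
  have F: "continuous_on {0..l e} (f \<circ> chart e)" if "e \<in> E" for e
    by (rule smooth_along_continuous[OF S(1,2) that])
  obtain K D where KD: "\<forall>e\<in>E. finite (K e) \<and>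
      (\<forall>x\<in>{0<..<l e} - K e. ((f \<circ> chart e) has_real_derivative D e x) (at x)) \<and>
      (\<lambda>x. (D e x)\<^sup>2) integrable_on {0..l e}"
    and mass: "mass_along S f = (\<Sum>e\<in>E. integral {0..l e} (\<lambda>x. ((f \<circ> chart e) x)\<^sup>2))"
    and energy: "energy_along S f = (\<Sum>e\<in>E. integral {0..l e} (\<lambda>x. (D e x)\<^sup>2))"
    using edge_integrals[OF S(1,2)] by (elim exE conjE)
  then have K: "finite (K e)"
    and D: "\<And>x. x \<in> {0<..<l e} - K e \<Longrightarrow> ((f \<circ> chart e) has_real_derivative D e x) (at x)"
    and D2: "(\<lambda>x. (D e x)\<^sup>2) integrable_on {0..l e}" if "e \<in> E" for e
    using that by blast+
  define q where "q e = integral {0..l e} (\<lambda>x. ((f \<circ> chart e) x)\<^sup>2)" for e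
  have mass_q: "mass_along S f = (\<Sum>e\<in>E. q e)" by (simp add: mass q_def)
  define y where "y v = f (\<phi> (vertex_point v))" for v
  define \<kappa> where "\<kappa> = (pi / (2 * max_length E l))\<^sup>2"
  have max: "l e \<le> max_length E l" if "e \<in> E" for e
    unfolding max_length_def using that finite_E by (intro Max_ge) auto
  have ends_energy: "\<kappa> * (q e - 2 * y v * integral {0..l e} (f \<circ> chart e) + (y v)\<^sup>2 * l e)
      \<le> integral {0..l e} (\<lambda>x. (D e x)\<^sup>2)" if e: "e \<in> E" and v: "v \<in> e" for e v
  proof -
    let ?g = "\<lambda>x. (f \<circ> chart e) x - y v"
    have l: "0 < l e" by (rule length_pos[OF e])
    have "v = a e \<or> v = b e" using v ends(1)[OF e] by auto
    then have zero: "?g 0 = 0 \<or> ?g (l e) = 0" using chart_ends[OF e] by (auto simp: y_def)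
    have "(pi / (2 * l e))\<^sup>2 * integral {0..l e} (\<lambda>x. (?g x)\<^sup>2) \<le> integral {0..l e} (\<lambda>x. (D e x)\<^sup>2)"
    proof (rule wirtinger_one_endpoint[OF l K[OF e] _ _ D2[OF e] zero])
      show "continuous_on {0..l e} ?g" by (intro continuous_intros F[OF e])
      fix x assume "x \<in> {0<..<l e} - K e"
      then show "(?g has_real_derivative D e x) (at x)"
        using DERIV_diff[OF D[OF e, of x] DERIV_const] by simp
    qed
    \<comment> \<open>Shorter edges have larger Wirtinger constants, so that of the longest edge
      serves them all. This is the only loss due to unequal lengths.\<close>
    moreover have "\<kappa> \<le> (pi / (2 * l e))\<^sup>2"
      unfolding \<kappa>_def using l max[OF e] by (intro power_mono divide_left_mono) auto
    then have "\<kappa> * integral {0..l e} (\<lambda>x. (?g x)\<^sup>2) \<le> (pi / (2 * l e))\<^sup>2 * integral {0..l e} (\<lambda>x. (?g x)\<^sup>2)"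
      by (intro mult_right_mono integral_nonneg integrable_continuous_interval continuous_intros F[OF e]) auto
    ultimately show ?thesis
      using integral_square_diff_const[OF less_imp_le[OF l] F[OF e]] by (simp add: q_def)
  qed
  have "\<kappa> * \<nu> / 2 * (\<Sum>e\<in>E. q e) \<le> (\<Sum>e\<in>E. integral {0..l e} (\<lambda>x. (D e x)\<^sup>2))"
  proof (rule star_cover_energy[OF two_vertices _ ends_energy])
    show "0 \<le> \<kappa>" by (simp add: \<kappa>_def)
    show "inner_on V (star_mean (\<lambda>e. integral {0..l e} (f \<circ> chart e)))
        (star_mean (\<lambda>e. integral {0..l e} (f \<circ> chart e))) \<le> (2 - \<nu>) * sum q E"
      unfolding q_def using \<nu> \<nu>2
      by (intro star_mean_bound two_vertices integral_square_le length_pos F)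
        (simp_all add: edge_mean_def)
  qed
  then have bound: "\<kappa> * \<nu> / 2 * mass_along S f \<le> energy_along S f"
    by (simp add: mass_q energy)
  have q_nonneg: "0 \<le> q e" if "e \<in> E" for e
    unfolding q_def
    by (intro integral_nonneg integrable_continuous_interval continuous_intros F[OF that]) auto
  \<comment> \<open>Division by zero would make the quotient 0. By continuity on every edge, zero
    mass forces \<open>f\<close> to vanish on \<open>M\<close>, and off \<open>M\<close> it vanishes
    by the encoding.\<close>
  have "mass_along S f \<noteq> 0"
  proof
    assume "mass_along S f = 0"
    then have "\<forall>e\<in>E. q e = 0"
      using q_nonneg finite_E by (simp add: mass_q sum_nonneg_eq_0_iff)
    then have zero: "f (chart e x) = 0" if "e \<in> E" "x \<in> {0..l e}" for e x
    proof -
      have cont: "continuous_on {0..l e} (\<lambda>x. ((f \<circ> chart e) x)\<^sup>2)"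
        by (intro continuous_intros F that)
      then have "((\<lambda>x. ((f \<circ> chart e) x)\<^sup>2) has_integral 0) {0..l e}"
        using \<open>\<forall>e\<in>E. q e = 0\<close> that(1) integrable_integral[OF integrable_continuous_interval[OF cont]]
        by (simp add: q_def)
      then have "((f \<circ> chart e) x)\<^sup>2 = 0"
        using has_integral_0_cbox_imp_0[of 0 "l e" "\<lambda>x. ((f \<circ> chart e) x)\<^sup>2" x] cont that length_pos[OF that(1)]
        by simp
      then show ?thesis by simp
    qed
    have "f x = 0" for x
    proof (cases "x \<in> M")
      case True
      then show ?thesis using zero unfolding carrier_eq by blast
    next
      case False
      then show ?thesis using f(1) by (simp add: Zh_def)
    qed
    with f(2) show False by (auto simp: fun_eq_iff)
  qed
  moreover have "0 \<le> mass_along S f"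
    using q_nonneg by (simp add: mass_q sum_nonneg)
  ultimately have "\<kappa> * \<nu> / 2 \<le> energy_along S f / mass_along S f"
    using bound by (simp add: pos_le_divide_eq)
  then show ?thesis by (simp add: S(3) \<kappa>_def power_divide power_mult_distrib)
qed

section \<open>Choosing a test function in a given space\<close>

lemma edge_mean_sum:
  assumes B: "finite B" "B \<subseteq> Zh M d"
  shows "edge_mean (\<Sum>f\<in>B. fscale (c f) f) = (\<lambda>v. \<Sum>f\<in>B. c f * edge_mean f v)"
proof
  fix v
  have "integral {0..l e} ((\<Sum>f\<in>B. fscale (c f) f) \<circ> chart e)
      = (\<Sum>f\<in>B. c f * integral {0..l e} (f \<circ> chart e))" if e: "e \<in> E" for e
  proof -
    have i: "(f \<circ> chart e) integrable_on {0..l e}" if "f \<in> B" for f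
      using Zh_continuous_on_edge[of f e] e that B(2) by (intro integrable_continuous_interval) blast
    have "(\<Sum>f\<in>B. fscale (c f) f) \<circ> chart e = (\<lambda>x. \<Sum>f\<in>B. c f * (f \<circ> chart e) x)"
      by (simp add: fun_eq_iff sum_fun_apply fscale_def)
    moreover have "((\<lambda>x. \<Sum>f\<in>B. c f * (f \<circ> chart e) x) has_integral
        (\<Sum>f\<in>B. c f * integral {0..l e} (f \<circ> chart e))) {0..l e}"
      by (intro has_integral_sum B(1) has_integral_mult_right integrable_integral i)
    ultimately show ?thesis by (simp add: integral_unique)
  qed
  then have "(\<Sum>e\<in>incident v. integral {0..l e} ((\<Sum>f\<in>B. fscale (c f) f) \<circ> chart e))
      = (\<Sum>e\<in>incident v. \<Sum>f\<in>B. c f * integral {0..l e} (f \<circ> chart e))"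
    by (intro sum.cong refl) (simp add: incident_def)
  also have "\<dots> = (\<Sum>f\<in>B. c f * (\<Sum>e\<in>incident v. integral {0..l e} (f \<circ> chart e)))"
    unfolding sum_distrib_left by (rule sum.swap)
  finally show "edge_mean (\<Sum>f\<in>B. fscale (c f) f) v = (\<Sum>f\<in>B. c f * edge_mean f v)"
    by (simp add: edge_mean_def star_mean_def sum_divide_distrib[of _ B])
qed

text \<open>Orthogonality to \<open>G\<close> is a system of \<open>card G\<close> linear equations
  in \<open>fun_vs.dim \<Lambda>\<close> unknown coefficients. Nontrivial coefficients give
  \<open>f \<noteq> 0\<close> by independence of the basis, even if all star means of
  \<open>f\<close> vanish.\<close>

lemma edge_mean_orthogonal_exists:
  assumes \<Lambda>: "fun_vs.subspace \<Lambda>" "\<Lambda> \<subseteq> Zh M d" and G: "finite G" "card G < fun_vs.dim \<Lambda>"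
  obtains f where "f \<in> \<Lambda>" "f \<noteq> 0" "edge_mean f \<in> orthogonal_complement V G"
proof -
  obtain B where B: "B \<subseteq> \<Lambda>" "fun_vs.independent B" "card B = fun_vs.dim \<Lambda>"
    using fun_vs.basis_exists by metis
  have finB: "finite B" using B(3) G(2) by (metis card.infinite not_less_zero)
  have BZ: "B \<subseteq> Zh M d" using B(1) \<Lambda>(2) by blast
  obtain c where c: "\<exists>f\<in>B. c f \<noteq> 0" "\<forall>g\<in>G. (\<Sum>f\<in>B. inner_on V (edge_mean f) g * c f) = 0"
    using homogeneous_system_nontrivial[OF G(1) finB, of "\<lambda>g f. inner_on V (edge_mean f) g"] G(2) B(3)
    by auto
  define f where "f = (\<Sum>f\<in>B. fscale (c f) f)"
  have mean: "edge_mean f = (\<lambda>v. \<Sum>f\<in>B. c f * edge_mean f v)"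
    unfolding f_def by (rule edge_mean_sum[OF finB BZ])
  show ?thesis
  proof (rule that)
    show "f \<in> \<Lambda>"
      unfolding f_def using B(1) \<Lambda>(1) by (intro fun_vs.subspace_sum fun_vs.subspace_scale) auto
    show "f \<noteq> 0"
      using fun_vs.dependent_finite[OF finB] B(2) c(1) by (auto simp: f_def)
    have "edge_mean f v = 0" if "v \<notin> V" for v
      using that by (simp add: edge_mean_def star_mean_def)
    moreover have "inner_on V (edge_mean f) g = 0" if "g \<in> G" for g
      using c(2) that by (simp add: mean inner_on_sum mult.commute)
    ultimately show "edge_mean f \<in> orthogonal_complement V G"
      by (simp add: orthogonal_complement_def)
  qed
qed

lemma metric_graph_eigenvalue_ge:
  assumes "k < card V"
  shows "ereal (pi\<^sup>2 / (8 * (max_length E l)\<^sup>2) * nr_eigenvalue V E l k) \<le> metric_graph_eigenvalue M d k"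
proof -
  interpret N: symmetric_operator V nr_kernel "normalized_laplacian E l"
    by (rule symmetric_operator_normalized_laplacian)
  define \<nu> where "\<nu> = nr_eigenvalue V E l k"
  obtain G where G: "finite G" "card G \<le> k"
    "\<And>g. g \<in> orthogonal_complement V G \<Longrightarrow> \<nu> * inner_on V g g \<le> inner_on V (normalized_laplacian E l g) g"
    and "eigenspace_on V (normalized_laplacian E l) \<nu> \<noteq> {0}"
    unfolding \<nu>_def nr_eigenvalue_def using N.eigenvalue_list_nth[OF assms] by metis
  then have \<nu>2: "\<nu> \<le> 2" by (intro nr_eigenvalue_le_2 two_vertices)
  show ?thesis
    unfolding metric_graph_eigenvalue_def \<nu>_def[symmetric]
  proof (rule INF_greatest)
    fix \<Lambda> assume "\<Lambda> \<in> {\<Lambda>. fun_vs.subspace \<Lambda> \<and> \<Lambda> \<subseteq> Zh M d \<and> fun_vs.dim \<Lambda> = k + 1}"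
    then have \<Lambda>: "fun_vs.subspace \<Lambda>" "\<Lambda> \<subseteq> Zh M d" "fun_vs.dim \<Lambda> = k + 1" by auto
    have "card G < fun_vs.dim \<Lambda>" using G(2) \<Lambda>(3) by simp
    then obtain f where f: "f \<in> \<Lambda>" "f \<noteq> 0" "edge_mean f \<in> orthogonal_complement V G"
      using edge_mean_orthogonal_exists[OF \<Lambda>(1,2) G(1)] by metis
    have "pi\<^sup>2 / (8 * (max_length E l)\<^sup>2) * \<nu> \<le> rayleigh M d f"
      using f \<Lambda>(2) by (intro rayleigh_ge \<nu>2 G(3)) auto
    then show "ereal (pi\<^sup>2 / (8 * (max_length E l)\<^sup>2) * \<nu>) \<le> (SUP f\<in>\<Lambda> - {0}. ereal (rayleigh M d f))"
      using f by (intro SUP_upper2[of f]) auto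
  qed
qed

end

theorem theorem3p4:
  fixes M :: "'a set" and d :: "'a \<Rightarrow> 'a \<Rightarrow> real"
    and V :: "'v set" and E :: "'v set set" and l :: "'v set \<Rightarrow> real" and k :: nat
  assumes "Metric_space M d"
    and "simple_graph_model M d V E l"
    and "card V \<ge> 2"
    and "k \<le> card V - 1"
  shows "metric_graph_eigenvalue M d k
      \<ge> ereal (pi\<^sup>2 / (8 * (max_length E l)\<^sup>2) * nr_eigenvalue V E l k)"
proof -
  interpret Metric_space M d by fact
  obtain \<phi> where \<phi>: "\<phi> ` realization V E = M"
    "\<forall>x\<in>realization V E. \<forall>y\<in>realization V E. d (\<phi> x) (\<phi> y) = realization_dist E l x y"
    using assms(2) unfolding simple_graph_model_def by blast
  interpret length_graph V E l
    using assms(2) by unfold_locales (auto simp: simple_graph_model_def)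
  have "\<forall>e\<in>E. \<exists>u v. e = {u, v} \<and> u \<noteq> v" using edge_ends by metis
  then obtain a b where "\<And>e. e \<in> E \<Longrightarrow> e = {a e, b e} \<and> a e \<noteq> b e" by metis
  with \<phi> assms(3) interpret modelled_metric_graph M d V E l \<phi> a b
    by unfold_locales auto
  show ?thesis using assms(3,4) by (intro metric_graph_eigenvalue_ge) linarith
qed

end
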